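(* For any positional scoring rule $X$, computing whether a coalition of manipulators can manipulate $X_{\uparrow}$ (the rule $X$ with top-truncated ballots evaluated by the round-up scheme) with weighted top-truncated votes, i.e. deciding CWCM with top-truncated votes for $X_{\uparrow}$, takes polynomial time, for any number of candidates.
   Context: An election has a finite set $C$ of $m$ candidates and voters with non-negative integer weights; a vote of weight $w$ counts as $w$ identical votes. A top-truncated vote (top order) is a linear order over a non-empty subset of $C$; the unranked candidates are regarded as tied with each other and below all ranked ones. A complete vote ranks all of $C$ and is a special case. A positional scoring rule $X$ is defined by a scoring vector $\langle\alpha_1,\dots,\alpha_m\rangle$ with $\alpha_1\ge\dots\ge\alpha_m$; on complete votes a candidate ranked in position $i$ receives $\alpha_i$ points, and the candidates with highest total (weighted) score are the winners. Round-up scheme $X_{\uparrow}$: in a vote ranking only $k<m$ candidates, the candidate in position $i\le k$ receives $\alpha_i$ and every unranked candidate receives $\alpha_m$. CWCM (Constructive Weighted Coalitional Manipulation) with top-truncated votes: given a set $S$ of weighted votes of the non-manipulators (possibly top-truncated), the weights of a set $T$ of manipulators' votes, and a preferred candidate $p$, decide whether the votes in $T$ can be cast (each as an arbitrary top-truncated or complete vote) so that $p$ is a winner (not necessarily the unique one) of the election with votes $S\cup T$.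
   Formalization: Scores are integers, and the scoring vector for the given number of candidates is part of the input, so time is polynomial in a length that includes it; for a rule whose vectors are not computable from the number of candidates, the claim would otherwise be false. *)

theory Defs
  imports Main
begin

section \<open>Deterministic multi-tape Turing machines\<close>

text \<open>
  States and tape symbols are natural numbers below the bounds given by the machine; symbol 0 is
  the blank. A tape is a pair \<open>(l, r)\<close>: \<open>l\<close> lists the cells to the left of the head, nearest
  first, and \<open>r\<close> lists the scanned cell followed by the cells to its right. Cells beyond the
  end of either list are blank, so tapes are infinite in both directions.
\<close>

type_synonym tape = "nat list \<times> nat list"

datatype move = Left | Stay | Right

fun cell :: "nat list \<Rightarrow> nat" where
  "cell [] = 0"
| "cell (a # as) = a"

fun read_tape :: "tape \<Rightarrow> nat" where
  "read_tape (l, r) = cell r"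

fun act_tape :: "nat \<times> move \<Rightarrow> tape \<Rightarrow> tape" where
  "act_tape (a, Left) (l, r) = (tl l, cell l # a # tl r)"
| "act_tape (a, Stay) (l, r) = (l, a # tl r)"
| "act_tape (a, Right) (l, r) = (a # l, tl r)"

record tm =
  num_tapes :: nat
  num_symbols :: nat
  num_states :: nat
  start_state :: nat
  accept_state :: nat
  reject_state :: nat
  delta :: "nat \<Rightarrow> nat list \<Rightarrow> nat \<times> (nat \<times> move) list"

definition wf_tm :: "tm \<Rightarrow> bool" where
  "wf_tm M \<longleftrightarrow>
     0 < num_tapes M \<and> 0 < num_symbols M \<and>
     start_state M < num_states M \<and> accept_state M < num_states M \<and>
     reject_state M < num_states M \<and> accept_state M \<noteq> reject_state M \<and>
     (\<forall>q as. q < num_states M \<and> length as = num_tapes M \<and> set as \<subseteq> {..<num_symbols M} \<longrightarrow>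
        (case delta M q as of (q', acts) \<Rightarrow>
           q' < num_states M \<and> length acts = num_tapes M \<and>
           fst ` set acts \<subseteq> {..<num_symbols M}))"

type_synonym config = "nat \<times> tape list"

definition init_config :: "tm \<Rightarrow> nat list \<Rightarrow> config" where
  "init_config M xs = (start_state M, ([], xs) # replicate (num_tapes M - 1) ([], []))"

fun step :: "tm \<Rightarrow> config \<Rightarrow> config" where
  "step M (q, ts) =
     (if q = accept_state M \<or> q = reject_state M then (q, ts)
      else case delta M q (map read_tape ts) of
        (q', acts) \<Rightarrow> (q', map2 act_tape acts ts))"

text \<open>
  A decision problem is given by a set \<open>I\<close> of instances, their encoding as nonblank words, and
  the predicate \<open>yes\<close>. As halting configurations are fixed points of \<^const>\<open>step\<close>, the equation
  below says that the machine halts with the right answer after at most the stated number of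
  steps, which is polynomial in the length of the encoding.
\<close>

definition polytime_decidable :: "'i set \<Rightarrow> ('i \<Rightarrow> nat list) \<Rightarrow> ('i \<Rightarrow> bool) \<Rightarrow> bool" where
  "polytime_decidable I enc yes \<longleftrightarrow>
     (\<exists>M b d. wf_tm M \<and>
        (\<forall>x\<in>I. set (enc x) \<subseteq> {0<..<num_symbols M} \<and>
           fst ((step M ^^ (b * length (enc x) ^ d + b)) (init_config M (enc x))) =
             (if yes x then accept_state M else reject_state M)))"

section \<open>Positional scoring rules and the round-up scheme\<close>

text \<open>
  A vote is the list of its ranked candidates, best first. Scoring vectors are integral, as they
  have to be written down as part of an input.
\<close>

definition top_order :: "'c set \<Rightarrow> 'c list \<Rightarrow> bool" where
  "top_order C v \<longleftrightarrow> v \<noteq> [] \<and> distinct v \<and> set v \<subseteq> C"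

definition scoring_vector :: "nat \<Rightarrow> int list \<Rightarrow> bool" where
  "scoring_vector m \<alpha> \<longleftrightarrow> length \<alpha> = m \<and> sorted_wrt (\<ge>) \<alpha>"

text \<open>A rule applies to any number of candidates: it provides a scoring vector for each.\<close>

definition positional_scoring_rule :: "(nat \<Rightarrow> int list) \<Rightarrow> bool" where
  "positional_scoring_rule X \<longleftrightarrow> (\<forall>m. scoring_vector m (X m))"

text \<open>Positions are counted from 0.\<close>

definition position :: "'c list \<Rightarrow> 'c \<Rightarrow> nat" where
  "position v c = length (takeWhile (\<lambda>d. d \<noteq> c) v)"

definition roundup_points :: "int list \<Rightarrow> 'c list \<Rightarrow> 'c \<Rightarrow> int" where
  "roundup_points \<alpha> v c = (if c \<in> set v then \<alpha> ! position v c else last \<alpha>)"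

definition roundup_score :: "int list \<Rightarrow> (nat \<times> 'c list) list \<Rightarrow> 'c \<Rightarrow> int" where
  "roundup_score \<alpha> V c = (\<Sum>(w, v)\<leftarrow>V. int w * roundup_points \<alpha> v c)"

definition roundup_winner ::
  "(nat \<Rightarrow> int list) \<Rightarrow> 'c set \<Rightarrow> (nat \<times> 'c list) list \<Rightarrow> 'c \<Rightarrow> bool" where
  "roundup_winner X C V c \<longleftrightarrow>
     c \<in> C \<and> (\<forall>d\<in>C. roundup_score (X (card C)) V d \<le> roundup_score (X (card C)) V c)"

definition roundup_manipulable ::
  "(nat \<Rightarrow> int list) \<Rightarrow> 'c set \<Rightarrow> (nat \<times> 'c list) list \<Rightarrow> nat list \<Rightarrow> 'c \<Rightarrow> bool" where
  "roundup_manipulable X C S T p \<longleftrightarrow>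
     (\<exists>vs. length vs = length T \<and> (\<forall>v\<in>set vs. top_order C v) \<and>
        roundup_winner X C (S @ zip T vs) p)"

section \<open>The decision problem\<close>

text \<open>
  An instance \<open>(m, S, T, p)\<close> has candidates \<open>0, \<dots>, m - 1\<close>, weighted votes \<open>S\<close> of the
  non-manipulators, weights \<open>T\<close> of the manipulators, and preferred candidate \<open>p\<close>.
\<close>

type_synonym cwcm_instance = "nat \<times> (nat \<times> nat list) list \<times> nat list \<times> nat"

definition cwcm_instances :: "cwcm_instance set" where
  "cwcm_instances =
     {(m, S, T, p). p < m \<and> (\<forall>(w, v)\<in>set S. top_order {..<m} v)}"

definition cwcm_roundup :: "(nat \<Rightarrow> int list) \<Rightarrow> cwcm_instance \<Rightarrow> bool" where
  "cwcm_roundup X = (\<lambda>(m, S, T, p). roundup_manipulable X {..<m} S T p)"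

text \<open>
  All numbers are written in binary, least significant digit first, with symbols 1 and 2 for the
  digits 0 and 1 and a leading 3 for a negative sign; 0 is the empty word. Symbol 4 terminates a
  list entry and symbol 5 a list. As a rule need not be computable, the vector \<open>X m\<close> is supplied
  with the instance; it also conveys \<open>m\<close>.
\<close>

fun encode_nat :: "nat \<Rightarrow> nat list" where
  "encode_nat n = (if n = 0 then [] else (if even n then 1 else 2) # encode_nat (n div 2))"

declare encode_nat.simps [simp del]

definition encode_int :: "int \<Rightarrow> nat list" where
  "encode_int i = (if i < 0 then [3] else []) @ encode_nat (nat \<bar>i\<bar>)"

definition encode_list :: "('a \<Rightarrow> nat list) \<Rightarrow> 'a list \<Rightarrow> nat list" where
  "encode_list enc xs = concat (map (\<lambda>x. enc x @ [4]) xs) @ [5]"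

definition encode_vote :: "nat \<times> nat list \<Rightarrow> nat list" where
  "encode_vote = (\<lambda>(w, v). encode_list encode_nat (w # v))"

definition encode_cwcm :: "(nat \<Rightarrow> int list) \<Rightarrow> cwcm_instance \<Rightarrow> nat list" where
  "encode_cwcm X = (\<lambda>(m, S, T, p).
     encode_list encode_int (X m) @ encode_list encode_vote S @
     encode_list encode_nat T @ encode_nat p)"

end

theory Submission
  imports Defs
begin

text \<open>
  Under the round-up scheme the bullet vote ranking only \<open>p\<close> gives \<open>p\<close> the maximal and every other
  candidate the minimal number of points, so all manipulators may be assumed to cast it. It remains
  to compare, for every candidate \<open>d\<close>, two explicit sums of products. Signed sums are handled by
  keeping two natural accumulators: a summand for one side of the inequality is added to the
  accumulator of the other side when it is negative, and only their difference matters. The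
  machine is written in a small language of structured tape programs.
\<close>

section \<open>Structured tape programs\<close>

text \<open>Round-up gives every unranked candidate the least entry, so one and the same ballot is
  best for \<open>p\<close> against all rivals at once and no distribution of the weights has to be
  searched for. What shapes the proof is that time is counted in transitions of a concrete machine
  on binary numbers. Weights may be exponential in the input length, but the vector has one entry
  per candidate, so a loop over candidates is short. The time bounds are coarse and follow from word
  lengths: for input length \<open>n\<close>, a product lengthens an accumulator by at most
  \<open>n\<close> digits and a score has at most \<open>n\<close> products, so
  \<open>N = 2 * (n + 1)^2\<close> bounds the accumulators after two scores. A product costs O(N^2),
  a score O(N^3), the loop over candidates O(N^4), which is degree 8 in \<open>n + 1\<close>.
  Trailing blanks make lists ambiguous as half tapes; programs therefore run on tapes stripped of
  them, and the machine is related to the program through \<open>canon\<close>.\<close>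

definition scons :: "nat \<Rightarrow> nat list \<Rightarrow> nat list" where
  "scons a l = (if a = 0 \<and> l = [] then [] else a # l)"

fun strip :: "nat list \<Rightarrow> nat list" where
  "strip [] = []"
| "strip (a # l) = scons a (strip l)"

text \<open>A list and its extension by blanks denote the same half tape. Choosing the
  representative without trailing blanks makes equal contents equal terms, and \<open>scons\<close>
  preserves this choice.\<close>

definition canon :: "tape \<Rightarrow> tape" where
  "canon t = map_prod strip strip t"

text \<open>The effect of an action on tapes without trailing blanks in either list.\<close>

fun act :: "nat \<times> move \<Rightarrow> tape \<Rightarrow> tape" where
  "act (a, Left) (l, r) = (tl l, scons (cell l) (scons a (tl r)))"
| "act (a, Stay) (l, r) = (l, scons a (tl r))"
| "act (a, Right) (l, r) = (scons a l, tl r)"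

lemma cell_scons [simp]: "cell (scons a l) = a"
  by (simp add: scons_def)

lemma tl_scons [simp]: "tl (scons a l) = l"
  by (simp add: scons_def)

lemma scons_nonblank [simp]: "a \<noteq> 0 \<Longrightarrow> scons a l = a # l"
  by (simp add: scons_def)

lemma scons_Cons [simp]: "scons a (b # l) = a # b # l"
  by (simp add: scons_def)

lemma scons_blank [simp]: "scons 0 [] = []"
  by (simp add: scons_def)

lemma scons_cell_tl: "0 \<notin> set l \<Longrightarrow> scons (cell l) (tl l) = l"
  by (cases l) auto

lemma cell_strip [simp]: "cell (strip l) = cell l"
  by (cases l) auto

lemma tl_strip: "tl (strip l) = strip (tl l)"
  by (cases l) auto

lemma scons_strip [simp]: "scons (cell l) (strip (tl l)) = strip l"
  by (cases l) auto

lemma strip_id: "0 \<notin> set l \<Longrightarrow> strip l = l"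
  by (induction l) auto

lemma read_canon [simp]: "read_tape (canon t) = read_tape t"
  by (cases t) (simp add: canon_def tl_strip)

lemma canon_act: "canon (act_tape x t) = act x (canon t)"
  by (cases "(x, t)" rule: act_tape.cases) (simp_all add: canon_def tl_strip)

lemma act_idle: "act (read_tape t, Stay) (canon t) = canon t"
  by (cases t) (simp add: canon_def tl_strip)

section \<open>Syntax and timed semantics of tape programs\<close>

datatype 'r com =
    Atom "('r \<Rightarrow> nat) \<Rightarrow> 'r \<rightharpoonup> nat \<times> move"
  | Seq "'r com" "'r com"  (infixr ";;" 60)
  | Cond "('r \<Rightarrow> nat) \<Rightarrow> bool" "'r com" "'r com"
  | Loop "('r \<Rightarrow> nat) \<Rightarrow> bool" "'r com"

text \<open>Control is the stack of commands still to be executed, and unfolding any construct costs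
  one transition. The empty stack idles, so a finished program keeps its tapes.\<close>

fun nxt :: "'r com list \<Rightarrow> ('r \<Rightarrow> nat) \<Rightarrow> 'r com list \<times> ('r \<rightharpoonup> nat \<times> move)" where
  "nxt [] rd = ([], Map.empty)"
| "nxt (Atom f # k) rd = (k, f rd)"
| "nxt ((a ;; b) # k) rd = (a # b # k, Map.empty)"
| "nxt (Cond Q a b # k) rd = ((if Q rd then a else b) # k, Map.empty)"
| "nxt (Loop Q a # k) rd = (if Q rd then a # Loop Q a # k else k, Map.empty)"

definition reads :: "('r \<Rightarrow> tape) \<Rightarrow> 'r \<Rightarrow> nat" where
  "reads s r = read_tape (s r)"

definition app :: "('r \<rightharpoonup> nat \<times> move) \<Rightarrow> ('r \<Rightarrow> tape) \<Rightarrow> 'r \<Rightarrow> tape" where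
  "app F s r = (case F r of None \<Rightarrow> s r | Some x \<Rightarrow> act x (s r))"

fun cstep :: "'r com list \<times> ('r \<Rightarrow> tape) \<Rightarrow> 'r com list \<times> ('r \<Rightarrow> tape)" where
  "cstep (k, s) = (case nxt k (reads s) of (k', F) \<Rightarrow> (k', app F s))"

text \<open>The quantifier over \<open>k\<close> makes runs composable in any context. The time is
  only an upper bound, so estimates can be rounded up at every stage.\<close>

definition runs :: "'r com \<Rightarrow> ('r \<Rightarrow> tape) \<Rightarrow> nat \<Rightarrow> ('r \<Rightarrow> tape) \<Rightarrow> bool" where
  "runs c s t s' \<longleftrightarrow> (\<exists>t'\<le>t. \<forall>k. (cstep ^^ t') (c # k, s) = (k, s'))"

lemma app_empty [simp]: "app Map.empty s = s"
  by (simp add: app_def fun_eq_iff)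

lemma app_upd [simp]: "app (F(i \<mapsto> x)) s = (app F s)(i := act x (s i))"
  by (simp add: app_def fun_eq_iff)

lemma runs_mono: "runs c s t s' \<Longrightarrow> t \<le> t' \<Longrightarrow> runs c s t' s'"
  unfolding runs_def by (meson le_trans)

lemma funpow_add_apply: "(f ^^ m) x = y \<Longrightarrow> (f ^^ n) y = z \<Longrightarrow> (f ^^ (m + n)) x = z"
  by (metis add.commute comp_apply funpow_add)

lemma runs_cstep:
  assumes "\<And>k. cstep (c # k, s) = (c' # k, s)" "runs c' s t s'"
  shows "runs c s (t + 1) s'"
proof -
  obtain t' where t': "t' \<le> t" "\<And>k. (cstep ^^ t') (c' # k, s) = (k, s')"
    using assms(2) by (auto simp: runs_def)
  have "(cstep ^^ (t' + 1)) (c # k, s) = (k, s')" for k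
    using assms(1)[of k] t'(2)[of k] by (simp add: funpow_swap1)
  then show ?thesis
    unfolding runs_def using t'(1) by (intro exI[of _ "t' + 1"]) auto
qed

lemma runs_Atom: "app (f (reads s)) s = s' \<Longrightarrow> runs (Atom f) s 1 s'"
  unfolding runs_def by (intro exI[of _ 1]) auto

lemma runs_Seq:
  assumes "runs a s t s1" "runs b s1 u s2"
  shows "runs (a ;; b) s (t + u + 1) s2"
proof -
  obtain t' where t': "t' \<le> t" "\<And>k. (cstep ^^ t') (a # k, s) = (k, s1)"
    using assms(1) by (auto simp: runs_def)
  obtain u' where u': "u' \<le> u" "\<And>k. (cstep ^^ u') (b # k, s1) = (k, s2)"
    using assms(2) by (auto simp: runs_def)
  have "(cstep ^^ (1 + (t' + u'))) ((a ;; b) # k, s) = (k, s2)" for k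
    by (intro funpow_add_apply[OF _ funpow_add_apply[OF t'(2) u'(2)]]) simp
  then show ?thesis
    unfolding runs_def using t'(1) u'(1) by (intro exI[of _ "1 + (t' + u')"]) auto
qed

lemma runs_Cond:
  assumes "runs (if Q (reads s) then a else b) s t s'"
  shows "runs (Cond Q a b) s (t + 1) s'"
  using assms by (intro runs_cstep) auto

lemma runs_Loop_done:
  assumes "\<not> Q (reads s)"
  shows "runs (Loop Q a) s 1 s"
  unfolding runs_def using assms by (intro exI[of _ 1]) auto

lemma runs_Loop_step:
  assumes "Q (reads s)" "runs a s t s1" "runs (Loop Q a) s1 u s2"
  shows "runs (Loop Q a) s (t + u + 1) s2"
proof -
  obtain t' where t': "t' \<le> t" "\<And>k. (cstep ^^ t') (a # k, s) = (k, s1)"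
    using assms(2) by (auto simp: runs_def)
  obtain u' where u': "u' \<le> u" "\<And>k. (cstep ^^ u') (Loop Q a # k, s1) = (k, s2)"
    using assms(3) by (auto simp: runs_def)
  have "(cstep ^^ (1 + (t' + u'))) (Loop Q a # k, s) = (k, s2)" for k
    by (intro funpow_add_apply[OF _ funpow_add_apply[OF t'(2) u'(2)]]) (simp add: assms(1))
  then show ?thesis
    unfolding runs_def using t'(1) u'(1) by (intro exI[of _ "1 + (t' + u')"]) auto
qed

section \<open>Compilation to Turing machines\<close>

text \<open>An over-approximation of the stacks that arise on the way from \<open>c # k\<close> to
  \<open>k\<close>. A loop puts itself into the continuation of its body, so structural recursion
  suffices and the set is finite, fit to be a state set. The final stack \<open>k\<close> is not
  inserted.\<close>

fun conts :: "'r com \<Rightarrow> 'r com list \<Rightarrow> 'r com list set" where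
  "conts (Atom f) k = {Atom f # k}"
| "conts (a ;; b) k = insert ((a ;; b) # k) (conts a (b # k) \<union> conts b k)"
| "conts (Cond Q a b) k = insert (Cond Q a b # k) (conts a k \<union> conts b k)"
| "conts (Loop Q a) k = insert (Loop Q a # k) (conts a (Loop Q a # k))"

lemma finite_conts: "finite (conts c k)"
  by (induction c arbitrary: k) auto

lemma in_conts: "c # k \<in> conts c k"
  by (cases c) auto

text \<open>Keeps the machine within its states: a step either stays among these stacks or, once the
  last command is finished, exposes \<open>k\<close>.\<close>

lemma conts_closed: "x \<in> conts c k \<Longrightarrow> fst (nxt x rd) \<in> insert k (conts c k)"
proof (induction c arbitrary: k)
  case (Seq a b)
  then consider "x = (a ;; b) # k" | "x \<in> conts a (b # k)" | "x \<in> conts b k"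
    by auto
  then show ?case
  proof cases
    case 2
    then show ?thesis
      using Seq.IH(1)[OF 2] in_conts[of b k] by (elim insertE) simp_all
  qed (use Seq.IH(2) in_conts[of a "b # k"] in auto)
next
  case (Cond Q a b)
  then show ?case
    using Cond.IH(1)[of k] Cond.IH(2)[of k] in_conts[of a k] in_conts[of b k] by auto
next
  case (Loop Q a)
  then show ?case
    using Loop.IH[of "Loop Q a # k"] in_conts[of a "Loop Q a # k"]
    by (auto split: if_splits)
qed auto

text \<open>Written symbols have to be below \<open>N\<close> only if the scanned ones are, so atoms
  that copy symbols qualify.\<close>

fun wfc :: "nat \<Rightarrow> 'r com \<Rightarrow> bool" where
  "wfc N (Atom f) \<longleftrightarrow> (\<forall>rd. (\<forall>r. rd r < N) \<longrightarrow> (\<forall>r x. f rd r = Some x \<longrightarrow> fst x < N))"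
| "wfc N (a ;; b) \<longleftrightarrow> wfc N a \<and> wfc N b"
| "wfc N (Cond Q a b) \<longleftrightarrow> wfc N a \<and> wfc N b"
| "wfc N (Loop Q a) \<longleftrightarrow> wfc N a"

lemma wfc_nxt:
  assumes "x \<in> conts c k" "wfc N c" "\<forall>r. rd r < N" "snd (nxt x rd) r = Some y"
  shows "fst y < N"
  using assms
proof (induction c arbitrary: k)
  case (Atom f)
  then show ?case
    by (simp del: split_paired_All)
next
  case (Seq a b)
  then show ?case
    using Seq.IH(1)[of "b # k"] Seq.IH(2)[of k] by auto
next
  case (Cond Q a b)
  then show ?case
    using Cond.IH(1)[of k] Cond.IH(2)[of k] by auto
next
  case (Loop Q a)
  then show ?case
    using Loop.IH[of "Loop Q a # k"] by (auto split: if_splits)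
qed

text \<open>A machine writes on every tape in every step, so inaction becomes writing back the
  scanned symbol.\<close>

definition acts :: "('r \<Rightarrow> nat) \<Rightarrow> ('r \<rightharpoonup> nat \<times> move) \<Rightarrow> 'r \<Rightarrow> nat \<times> move" where
  "acts rd F r = (case F r of None \<Rightarrow> (rd r, Stay) | Some x \<Rightarrow> x)"

text \<open>The states are the finitely many continuations \<^term>\<open>k\<close>, numbered by \<^term>\<open>h\<close>.\<close>

definition compile ::
  "nat \<Rightarrow> 'r list \<Rightarrow> 'r com \<Rightarrow> (('r \<Rightarrow> nat) \<Rightarrow> bool) \<Rightarrow> ('r com list \<Rightarrow> nat) \<Rightarrow> nat \<Rightarrow> tm" where
  "compile N rs c Q h n =
    \<lparr>num_tapes = length rs, num_symbols = N, num_states = n + 2, start_state = h [c],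
     accept_state = n, reject_state = n + 1,
     delta = (\<lambda>q as.
       let rd = (\<lambda>r. the (map_of (zip rs as) r));
           k = inv_into (insert [] (conts c [])) h q
       in if n \<le> q then (q, map (acts rd Map.empty) rs)
          else if k = [] then (if Q rd then n else n + 1, map (acts rd Map.empty) rs)
          else case nxt k rd of (k', F) \<Rightarrow> (h k', map (acts rd F) rs))\<rparr>"

text \<open>Writing back a blank scanned at the end of a list extends the raw tape by a visible
  blank; only the canonical form is unchanged.\<close>

lemma canon_acts:
  "canon (act_tape (acts rd F r) t) = (case F r of None \<Rightarrow> canon t | Some x \<Rightarrow> act x (canon t))"
  if "rd r = read_tape t"
  using that by (simp add: acts_def canon_act act_idle split: option.splits)

lemma map2_map: "map2 f (map g xs) (map h xs) = map (\<lambda>x. f (g x) (h x)) xs"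
  by (induction xs) auto

section \<open>Simulation of a program by its compiled machine\<close>

locale compilation =
  fixes N :: nat and rs :: "'r list" and c :: "'r com"
    and Q :: "('r \<Rightarrow> nat) \<Rightarrow> bool" and h :: "'r com list \<Rightarrow> nat" and n :: nat
  assumes rs: "distinct rs" "set rs = UNIV"
    and wf: "wfc N c" "0 < N"
    and h: "bij_betw h (insert [] (conts c [])) {..<n}"
begin

abbreviation "M \<equiv> compile N rs c Q h n"

lemma h_less: "k \<in> insert [] (conts c []) \<Longrightarrow> h k < n"
  using h by (auto simp: bij_betw_def)

lemma inv_h: "k \<in> insert [] (conts c []) \<Longrightarrow> inv_into (insert [] (conts c [])) h (h k) = k"
  using h by (auto simp: bij_betw_def intro!: inv_into_f_f)

lemma the_map_of: "the (map_of (zip rs (map f rs)) r) = f r"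
  by (simp add: map_of_zip_map rs)

lemma step_nonempty:
  assumes k: "k \<in> conts c []" "k \<noteq> []" and step: "cstep (k, canon \<circ> \<sigma>) = (k', s')"
  shows "\<exists>\<sigma>'. step M (h k, map \<sigma> rs) = (h k', map \<sigma>' rs) \<and> canon \<circ> \<sigma>' = s'"
proof -
  let ?rd = "read_tape \<circ> \<sigma>"
  obtain F where F: "nxt k ?rd = (k', F)" "s' = app F (canon \<circ> \<sigma>)"
    using step by (auto simp: reads_def[abs_def] o_def split: prod.splits)
  have "h k < n"
    using h_less k by auto
  moreover have "(\<lambda>r. the (map_of (zip rs (map (read_tape \<circ> \<sigma>) rs)) r)) = ?rd"
    by (simp only: the_map_of)
  ultimately have "step M (h k, map \<sigma> rs) = (h k', map (\<lambda>r. act_tape (acts ?rd F r) (\<sigma> r)) rs)"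
    using k F by (simp add: compile_def inv_h Let_def map2_map)
  moreover have "canon \<circ> (\<lambda>r. act_tape (acts ?rd F r) (\<sigma> r)) = s'"
    by (simp add: fun_eq_iff F app_def canon_acts split: option.split)
  ultimately show ?thesis
    by blast
qed

lemma step_empty:
  "fst (step M (h [], map \<sigma> rs)) = (if Q (reads (canon \<circ> \<sigma>)) then n else n + 1)"
proof -
  have "h [] < n"
    using h_less by auto
  moreover have "(\<lambda>r. the (map_of (zip rs (map (read_tape \<circ> \<sigma>) rs)) r)) = reads (canon \<circ> \<sigma>)"
    by (simp only: the_map_of) (simp add: reads_def[abs_def] o_def)
  ultimately show ?thesis
    by (simp add: compile_def inv_h Let_def)
qed

text \<open>The program may idle on the empty stack until time \<open>t\<close>, whereas the machine
  leaves the state \<open>h []\<close> for a verdict. The machine is therefore followed only up to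
  its first arrival there, at some \<open>u\<close> bounded by \<open>t\<close>.\<close>

lemma simulation:
  assumes "(cstep ^^ t) (k, canon \<circ> \<sigma>) = ([], s')" "k \<in> insert [] (conts c [])"
  shows "\<exists>u\<le>t. \<exists>\<sigma>'. (step M ^^ u) (h k, map \<sigma> rs) = (h [], map \<sigma>' rs) \<and> canon \<circ> \<sigma>' = s'"
  using assms
proof (induction t arbitrary: k \<sigma>)
  case 0
  then show ?case by auto
next
  case (Suc t)
  show ?case
  proof (cases "k = []")
    case True
    have "cstep ([], s) = ([], s)" for s :: "'r \<Rightarrow> tape"
      by simp
    then have "(cstep ^^ j) ([], s) = ([], s)" for j and s :: "'r \<Rightarrow> tape"
      by (induction j) simp_all
    then have "s' = canon \<circ> \<sigma>"
      using Suc.prems(1) True by (metis prod.inject)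
    with True show ?thesis
      by (intro exI[of _ 0]) auto
  next
    case False
    obtain k' s1 where 1: "cstep (k, canon \<circ> \<sigma>) = (k', s1)"
      by fastforce
    obtain \<sigma>1 where 2: "step M (h k, map \<sigma> rs) = (h k', map \<sigma>1 rs)" "canon \<circ> \<sigma>1 = s1"
      using step_nonempty[OF _ False 1] Suc.prems(2) False by auto
    have "k' = fst (nxt k (reads (canon \<circ> \<sigma>)))"
      using 1 by (auto split: prod.splits)
    then have "k' \<in> insert [] (conts c [])"
      using conts_closed[of k c "[]"] Suc.prems(2) False by auto
    moreover have "(cstep ^^ t) (k', canon \<circ> \<sigma>1) = ([], s')"
      using Suc.prems(1) 1 2(2) by (simp add: funpow_swap1 o_def del: cstep.simps)
    ultimately obtain u \<sigma>' where "u \<le> t" "canon \<circ> \<sigma>' = s'"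
      "(step M ^^ u) (h k', map \<sigma>1 rs) = (h [], map \<sigma>' rs)"
      using Suc.IH by blast
    with 2(1) show ?thesis
      by (intro exI[of _ "Suc u"] conjI exI[of _ \<sigma>']) (simp_all add: funpow_swap1 del: step.simps)
  qed
qed

lemma wf_compile:
  assumes "rs \<noteq> []"
  shows "wf_tm M"
proof -
  have "case delta M q as of (q', as') \<Rightarrow>
      q' < n + 2 \<and> length as' = length rs \<and> fst ` set as' \<subseteq> {..<N}"
    if q: "q < n + 2" and as: "length as = length rs" "set as \<subseteq> {..<N}" for q as
  proof -
    define rd where "rd = (\<lambda>r. the (map_of (zip rs as) r))"
    have rd: "\<forall>r. rd r < N"
    proof
      fix r
      obtain a where "map_of (zip rs as) r = Some a"
        using map_of_zip_is_Some[OF as(1)[symmetric], of r] rs(2) by auto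
      then have "a \<in> set as"
        by (meson map_of_SomeD set_zip_rightD)
      then show "rd r < N"
        using as(2) \<open>map_of _ r = _\<close> by (auto simp: rd_def)
    qed
    then have idle: "fst ` set (map (acts rd Map.empty) rs) \<subseteq> {..<N}"
      by (auto simp: acts_def)
    define k where "k = inv_into (insert [] (conts c [])) h q"
    show ?thesis
    proof (cases "q < n \<and> k \<noteq> []")
      case True
      have "k \<in> insert [] (conts c [])"
        using True h unfolding k_def by (intro inv_into_into) (auto simp: bij_betw_def)
      with True have k: "k \<in> conts c []"
        by auto
      obtain k' F where F: "nxt k rd = (k', F)"
        by fastforce
      have "h k' < n"
        using conts_closed[OF k, of rd] F by (intro h_less) auto
      moreover have "fst ` set (map (acts rd F) rs) \<subseteq> {..<N}"
        using wfc_nxt[OF k wf(1) rd] rd F by (fastforce simp: acts_def split: option.splits)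
      ultimately show ?thesis
        using True F unfolding compile_def rd_def k_def by (simp add: Let_def)
    qed (use q idle in \<open>auto simp: compile_def Let_def rd_def k_def\<close>)
  qed
  moreover have "h [c] < n"
    by (intro h_less) (simp add: in_conts)
  ultimately show ?thesis
    using assms wf(2) unfolding wf_tm_def by (simp add: compile_def)
qed

end

text \<open>An early verdict is as good as one at the prescribed time, since halting configurations
  are fixed points; so an upper bound on a run of \<open>c\<close> suffices.\<close>

lemma polytime_decidableI:
  fixes c :: "'r com"
  assumes rs: "distinct (i # rs)" "set (i # rs) = UNIV"
    and wf: "wfc N c" "0 < N"
    and enc: "\<And>x. x \<in> I \<Longrightarrow> set (enc x) \<subseteq> {0<..<N}"
    and run: "\<And>x. x \<in> I \<Longrightarrow> \<exists>s'. runs c ((\<lambda>_. ([], []))(i := ([], enc x)))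
      (b * (length (enc x) + 1) ^ d) s' \<and> (Q (reads s') \<longleftrightarrow> yes x)"
  shows "polytime_decidable I enc yes"
proof -
  let ?St = "insert [] (conts c [])"
  obtain h :: "'r com list \<Rightarrow> nat" and n where h: "bij_betw h ?St {..<n}"
    using ex_bij_betw_finite_nat[of ?St] finite_conts by (metis atLeast0LessThan finite.insertI)
  interpret compilation N "i # rs" c Q h n
    by unfold_locales (fact rs wf h)+
  have "fst ((step M ^^ ((b + 1) * 2 ^ d * length (enc x) ^ d + (b + 1) * 2 ^ d))
      (init_config M (enc x))) = (if yes x then accept_state M else reject_state M)"
    if x: "x \<in> I" for x
  proof -
    define s :: "'r \<Rightarrow> tape" where "s = (\<lambda>_. ([], []))(i := ([], enc x))"
    let ?n = "length (enc x)"
    obtain s' where "runs c s (b * (?n + 1) ^ d) s'" and s': "Q (reads s') \<longleftrightarrow> yes x"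
      using run[OF x] by (auto simp: s_def)
    then obtain t where t: "t \<le> b * (?n + 1) ^ d" "(cstep ^^ t) ([c], s) = ([], s')"
      by (auto simp: runs_def)
    \<comment> \<open>Encodings contain no blank, so the initial tapes are already
      canonical.\<close>
    have "canon \<circ> s = s"
      using enc[OF x] by (auto simp: fun_eq_iff s_def canon_def intro!: strip_id)
    then obtain u \<sigma>' where u: "u \<le> t" "canon \<circ> \<sigma>' = s'"
      "(step M ^^ u) (h [c], map s (i # rs)) = (h [], map \<sigma>' (i # rs))"
      using simulation[of t "[c]" s s'] t(2) in_conts[of c "[]"] by auto
    have "map s (i # rs) = ([], enc x) # replicate (length rs) ([], [])"
      using rs(1) by (auto simp: s_def intro!: replicate_eqI)
    then have "init_config M (enc x) = (h [c], map s (i # rs))"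
      by (simp add: init_config_def compile_def)
    then have fin: "fst ((step M ^^ (u + 1)) (init_config M (enc x))) =
        (if yes x then accept_state M else reject_state M)"
      using step_empty[of \<sigma>'] u s' by (simp add: compile_def del: step.simps)
    have "step M cf = cf" if "fst cf \<in> {accept_state M, reject_state M}" for cf
      using that by (cases cf) auto
    then have fixed: "(step M ^^ j) cf = cf" if "fst cf \<in> {accept_state M, reject_state M}" for j cf
      using that by (induction j) auto
    \<comment> \<open>The verdict costs one transition beyond the run, hence \<open>b + 1\<close>.
      For input length \<open>n\<close>, \<open>n + 1 <= 2 * max n 1\<close> yields
      \<open>(n + 1) ^ d <= 2 ^ d * (n ^ d + 1)\<close>, the shape that
      \<open>polytime_decidable\<close> prescribes.\<close>
    let ?K = "(b + 1) * 2 ^ d * ?n ^ d + (b + 1) * 2 ^ d"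
    have "(?n + 1) ^ d \<le> (2 * max ?n 1) ^ d"
      by (intro power_mono) auto
    also have "\<dots> \<le> 2 ^ d * (?n ^ d + 1)"
      by (cases "?n = 0") (auto simp: power_mult_distrib max_def)
    finally have "(b + 1) * (?n + 1) ^ d \<le> (b + 1) * (2 ^ d * (?n ^ d + 1))"
      by (rule mult_le_mono2)
    moreover have "b * (?n + 1) ^ d + 1 \<le> (b + 1) * (?n + 1) ^ d"
      by simp
    ultimately have "u + 1 \<le> (b + 1) * (2 ^ d * (?n ^ d + 1))"
      using u(1) t(1) by linarith
    then have "u + 1 \<le> ?K"
      by (simp add: algebra_simps)
    then obtain j where "?K = j + (u + 1)"
      by (metis le_add_diff_inverse2)
    then have "(step M ^^ ?K) (init_config M (enc x)) =
        (step M ^^ j) ((step M ^^ (u + 1)) (init_config M (enc x)))"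
      by (simp only: funpow_add o_apply)
    moreover have "fst ((step M ^^ (u + 1)) (init_config M (enc x))) \<in>
        {accept_state M, reject_state M}"
      unfolding fin by simp
    ultimately show ?thesis
      using fixed fin by (simp only:)
  qed
  then show ?thesis
    unfolding polytime_decidable_def using wf_compile enc
    by (intro exI[of _ M] exI[of _ "(b + 1) * 2 ^ d"] exI[of _ d]) (auto simp: compile_def)
qed

\<comment> \<open>Unapplied updates must stay folded: they are the symbolic states of program runs.\<close>
declare fun_upd_apply [simp del] fun_upd_same [simp] fun_upd_other [simp]

section \<open>Scanning and copying\<close>

definition right :: "'r \<Rightarrow> 'r com" where
  "right i = Atom (\<lambda>rd. [i \<mapsto> (rd i, Right)])"

definition left :: "'r \<Rightarrow> 'r com" where
  "left i = Atom (\<lambda>rd. [i \<mapsto> (rd i, Left)])"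

definition put :: "'r \<Rightarrow> nat \<Rightarrow> 'r com" where
  "put i a = Atom (\<lambda>rd. [i \<mapsto> (a, Stay)])"

definition skip :: "nat set \<Rightarrow> 'r \<Rightarrow> 'r com" where
  "skip X i = Loop (\<lambda>rd. rd i \<notin> X) (right i)"

text \<open>The initial move makes the search start strictly to the left of the head. It ends just
  to the right of the nearest symbol in \<open>X\<close>; with 0 in \<open>X\<close>, the start of
  the tape is such a place.\<close>

definition rewind :: "nat set \<Rightarrow> 'r \<Rightarrow> 'r com" where
  "rewind X i = left i ;; Loop (\<lambda>rd. rd i \<notin> X) (left i) ;; right i"

definition copy :: "nat set \<Rightarrow> 'r \<Rightarrow> 'r \<Rightarrow> 'r com" where
  "copy X i j = Loop (\<lambda>rd. rd i \<notin> X) (Atom (\<lambda>rd. [i \<mapsto> (rd i, Right), j \<mapsto> (rd i, Right)]))"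

text \<open>The head drifts to the right, but tapes are infinite in both directions and the erased
  cells are dropped from the left half, so the result is a fresh tape.\<close>

definition clear :: "'r \<Rightarrow> 'r com" where
  "clear i = Loop (\<lambda>rd. rd i \<noteq> 0) (Atom (\<lambda>rd. [i \<mapsto> (0, Right)]))"

lemma runs_eq: "runs c s t s1 \<Longrightarrow> s1 = s' \<Longrightarrow> t \<le> t' \<Longrightarrow> runs c s t' s'"
  by (simp add: runs_mono)

lemma reads_cell: "s i = (l, r) \<Longrightarrow> reads s i = cell r"
  by (simp add: reads_def)

lemma cell_eq_0: "0 \<notin> set l \<Longrightarrow> cell l = 0 \<longleftrightarrow> l = []"
  by (cases l) auto

lemma runs_right: "s i = (l, r) \<Longrightarrow> runs (right i) s 1 (s(i := (scons (cell r) l, tl r)))"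
  unfolding right_def by (intro runs_Atom) (simp add: reads_cell)

lemma runs_left:
  "s i = (l, r) \<Longrightarrow> 0 \<notin> set r \<Longrightarrow> runs (left i) s 1 (s(i := (tl l, scons (cell l) r)))"
  unfolding left_def by (intro runs_Atom) (simp add: reads_cell scons_cell_tl)

lemma runs_put: "s i = (l, r) \<Longrightarrow> runs (put i a) s 1 (s(i := (l, scons a (tl r))))"
  unfolding put_def by (intro runs_Atom) simp

text \<open>A round costs two transitions, one for the test and one for the move; the failing test
  adds the last one. The other scanning loops are counted in the same way.\<close>

lemma runs_skip:
  assumes "s i = (l, u @ r)" "set u \<inter> X = {}" "0 \<notin> set u" "cell r \<in> X"
  shows "runs (skip X i) s (2 * length u + 1) (s(i := (rev u @ l, r)))"
  using assms unfolding skip_def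
proof (induction u arbitrary: s l)
  case Nil
  then have "s(i := (l, r)) = s"
    by (auto simp: fun_eq_iff fun_upd_apply)
  with Nil show ?case
    using runs_Loop_done[of "\<lambda>rd. rd i \<notin> X" s] by (simp add: reads_cell)
next
  case (Cons x u)
  let ?s = "s(i := (x # l, u @ r))"
  have "runs (right i) s 1 ?s"
    using runs_right[of s i] Cons.prems by simp
  from runs_Loop_step[OF _ this Cons.IH[of ?s "x # l"]] Cons.prems show ?case
    by (simp add: reads_cell)
qed

lemma runs_copy:
  assumes "s i = (l, u @ r)" "s j = (l', [])" "i \<noteq> j"
    and "set u \<inter> X = {}" "0 \<notin> set u" "cell r \<in> X"
  shows "runs (copy X i j) s (2 * length u + 1) (s(i := (rev u @ l, r), j := (rev u @ l', [])))"
  using assms unfolding copy_def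
proof (induction u arbitrary: s l l')
  case Nil
  then have "s(i := (l, r), j := (l', [])) = s"
    by (auto simp: fun_eq_iff fun_upd_apply)
  with Nil show ?case
    using runs_Loop_done[of "\<lambda>rd. rd i \<notin> X" s] by (simp add: reads_cell)
next
  case (Cons x u)
  let ?s = "s(i := (x # l, u @ r), j := (x # l', []))"
  have "runs (Atom (\<lambda>rd. [i \<mapsto> (rd i, Right), j \<mapsto> (rd i, Right)])) s 1 ?s"
    using Cons.prems by (intro runs_Atom) (simp add: reads_cell)
  from runs_Loop_step[OF _ this Cons.IH[of ?s "x # l" "x # l'"]] Cons.prems show ?case
    by (simp add: reads_cell fun_upd_twist)
qed

lemma runs_rewind:
  assumes "s i = (u @ l, r)" "set u \<inter> X = {}" "0 \<notin> set l" "0 \<notin> set r" "cell l \<in> X"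
    and "0 \<notin> set u"
  shows "runs (rewind X i) s (2 * length u + 5) (s(i := (l, rev u @ r)))"
proof -
  \<comment> \<open>The loop is described from the position after the first move left, where the
    scanned symbol is already the head of \<open>u @ l\<close>; this treats an empty
    \<open>u\<close> uniformly.\<close>
  have loop: "runs (Loop (\<lambda>rd. rd i \<notin> X) (left i)) s (2 * length u + 1)
      (s(i := (tl l, scons (cell l) (rev u @ r))))"
    if "s i = (tl (u @ l), scons (cell (u @ l)) r)" "set u \<inter> X = {}" "0 \<notin> set u" "0 \<notin> set r"
    for s :: "'a \<Rightarrow> tape" and u r
    using that
  proof (induction u arbitrary: s r)
    case Nil
    then have "s(i := (tl l, scons (cell l) r)) = s"
      by (auto simp: fun_eq_iff fun_upd_apply)
    with Nil show ?case
      using runs_Loop_done[of "\<lambda>rd. rd i \<notin> X" s] assms(5) by (simp add: reads_cell)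
  next
    case (Cons x u)
    let ?s = "s(i := (tl (u @ l), scons (cell (u @ l)) (x # r)))"
    have "runs (left i) s 1 ?s"
      using runs_left[of s i] Cons.prems by simp
    from runs_Loop_step[OF _ this Cons.IH[of ?s "x # r"]] Cons.prems show ?case
      by (simp add: reads_cell)
  qed
  let ?s1 = "s(i := (tl (u @ l), scons (cell (u @ l)) r))"
  have 1: "runs (left i) s 1 ?s1"
    using runs_left[of s i] assms by simp
  have 2: "runs (Loop (\<lambda>rd. rd i \<notin> X) (left i)) ?s1 (2 * length u + 1)
      (s(i := (tl l, scons (cell l) (rev u @ r))))"
    using loop[of ?s1 u r] assms by simp
  have 3: "runs (right i) (s(i := (tl l, scons (cell l) (rev u @ r)))) 1 (s(i := (l, rev u @ r)))"
    using runs_right[of "s(i := (tl l, scons (cell l) (rev u @ r)))" i] assms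
    by (simp add: scons_cell_tl)
  show ?thesis
    unfolding rewind_def using runs_Seq[OF 1 runs_Seq[OF 2 3]] by (rule runs_mono) simp
qed

lemma runs_clear:
  assumes "s i = ([], u)" "0 \<notin> set u"
  shows "runs (clear i) s (2 * length u + 1) (s(i := ([], [])))"
  using assms unfolding clear_def
proof (induction u arbitrary: s)
  case Nil
  then have "s(i := ([], [])) = s"
    by (auto simp: fun_eq_iff fun_upd_apply)
  with Nil show ?case
    using runs_Loop_done[of "\<lambda>rd. rd i \<noteq> 0" s] by (simp add: reads_cell)
next
  case (Cons x u)
  let ?s = "s(i := ([], u))"
  have "runs (Atom (\<lambda>rd. [i \<mapsto> (0, Right)])) s 1 ?s"
    using Cons.prems by (intro runs_Atom) (simp add: reads_cell)
  from runs_Loop_step[OF _ this Cons.IH[of ?s]] Cons.prems show ?case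
    by (simp add: reads_cell)
qed

section \<open>Binary arithmetic\<close>

text \<open>The blank counts as digit 0, so words of different lengths can be processed column by
  column without padding.\<close>

definition digit :: "nat \<Rightarrow> nat" where
  "digit a = (if a = 2 then 1 else 0)"

fun val :: "nat list \<Rightarrow> nat" where
  "val [] = 0"
| "val (a # l) = digit a + 2 * val l"

text \<open>In contrast to \<open>encode_nat\<close>, high-order zeros are allowed. Accumulators
  need not be normalized, and the arithmetic lemmas fix only their value and a bound on their
  length.\<close>

definition bits :: "nat list \<Rightarrow> bool" where
  "bits l \<longleftrightarrow> set l \<subseteq> {1, 2}"

lemma bits_Nil [simp]: "bits []"
  by (simp add: bits_def)

lemma bits_Cons [simp]: "bits (a # l) \<longleftrightarrow> (a = 1 \<or> a = 2) \<and> bits l"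
  by (simp add: bits_def)

lemma bits_tl: "bits l \<Longrightarrow> bits (tl l)"
  by (cases l) auto

lemma bits_notin: "bits l \<Longrightarrow> a \<noteq> 1 \<Longrightarrow> a \<noteq> 2 \<Longrightarrow> a \<notin> set l"
  by (auto simp: bits_def)

lemma val_tl: "val l = digit (cell l) + 2 * val (tl l)"
  by (cases l) (auto simp: digit_def)

lemma bits_encode_nat: "bits (encode_nat n)"
  by (induction n rule: encode_nat.induct) (subst encode_nat.simps, simp)

lemma val_encode_nat: "val (encode_nat n) = n"
  by (induction n rule: encode_nat.induct) (subst encode_nat.simps, auto simp: digit_def)

lemma encode_nat_inj: "encode_nat m = encode_nat n \<longleftrightarrow> m = n"
  by (metis val_encode_nat)

text \<open>Programs have no storage besides tapes, so a Boolean is a tape with at most one nonblank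
  cell; the symbol 2 makes \<open>digit\<close> of that cell the bit itself.\<close>

definition flag :: "bool \<Rightarrow> tape" where
  "flag b = ([], if b then [2] else [])"

section \<open>Addition\<close>

definition add_step :: "'r \<Rightarrow> 'r \<Rightarrow> 'r \<Rightarrow> ('r \<Rightarrow> nat) \<Rightarrow> 'r \<rightharpoonup> nat \<times> move" where
  "add_step A W C rd =
     (let t = digit (rd A) + digit (rd W) + digit (rd C)
      in [A \<mapsto> (if odd t then 2 else 1, Right),
          W \<mapsto> (rd W, if rd W = 0 then Stay else Right),
          C \<mapsto> (if 2 \<le> t then 2 else 0, Stay)])"

definition add :: "'r \<Rightarrow> 'r \<Rightarrow> 'r \<Rightarrow> 'r com" where
  "add A W C =
     Loop (\<lambda>rd. rd A \<noteq> 0 \<or> rd W \<noteq> 0 \<or> rd C \<noteq> 0) (Atom (add_step A W C)) ;;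
     rewind {0} A ;; rewind {0} W"

text \<open>Induction on a common bound \<open>k\<close>, since columns continue until both words
  and the carry are used up; the last carry accounts for the extra digit. A head moving past the
  blank after \<open>W\<close> would leave blanks behind it, at which the later
  \<open>rewind {0}\<close> would stop too early; \<open>add_step\<close> makes it wait
  instead.\<close>

lemma runs_add_loop:
  assumes "s A = (l, a)" "s W = (l', w)" "s C = flag c" "distinct [A, W, C]"
    and "bits a" "bits w" "length a \<le> k" "length w \<le> k"
  shows "\<exists>a'. bits a' \<and> val a' = val a + val w + of_bool c \<and> length a' \<le> k + 1 \<and>
    runs (Loop (\<lambda>rd. rd A \<noteq> 0 \<or> rd W \<noteq> 0 \<or> rd C \<noteq> 0) (Atom (add_step A W C))) s (2 * k + 3)
      (s(A := (rev a' @ l, []), W := (rev w @ l', []), C := flag False))"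
    (is "\<exists>a'. _ \<and> _ \<and> _ \<and> runs ?loop _ _ _")
  using assms
proof (induction k arbitrary: s a w c l l')
  have step: "runs (Atom (add_step A W C)) s 1
      (s(A := ((if odd t then 2 else 1) # l, tl a),
         W := (if w = [] then l' else cell w # l', tl w), C := flag (2 \<le> t)))"
    if "s A = (l, a)" "s W = (l', w)" "s C = flag c" "distinct [A, W, C]" "bits w"
      and "t = digit (cell a) + digit (cell w) + of_bool c"
    for s :: "'a \<Rightarrow> tape" and l a l' w c t
    using that
    by (intro runs_Atom) (cases w; auto simp: reads_cell add_step_def Let_def flag_def digit_def fun_eq_iff fun_upd_apply)
  have halt: "runs ?loop s 1 (s(A := (l, []), W := (l', []), C := flag False))"
    if "s A = (l, [])" "s W = (l', [])" "s C = flag False" for s :: "'a \<Rightarrow> tape" and l l'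
  proof -
    have "s(A := (l, []), W := (l', []), C := flag False) = s"
      using that by (auto simp: fun_eq_iff fun_upd_apply)
    with that show ?thesis
      using runs_Loop_done[of "\<lambda>rd. rd A \<noteq> 0 \<or> rd W \<noteq> 0 \<or> rd C \<noteq> 0" s]
      by (simp add: reads_cell flag_def)
  qed
  {
    case 0
    show ?case
    proof (cases c)
      case False
      then show ?thesis
        using 0 halt[of s l l'] by (intro exI[of _ "[]"]) (auto intro: runs_mono)
    next
      case True
      let ?s = "s(A := (2 # l, []), W := (l', []), C := flag False)"
      have 1: "runs (Atom (add_step A W C)) s 1 ?s"
        using step[of s l a l' w c 1] 0 True by (simp add: digit_def)
      have 2: "runs ?loop ?s 1 (?s(A := (2 # l, []), W := (l', []), C := flag False))"
        using 0 by (intro halt) auto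
      have "runs ?loop s (1 + 1 + 1) (?s(A := (2 # l, []), W := (l', []), C := flag False))"
        by (rule runs_Loop_step[OF _ 1 2]) (use 0 True in \<open>simp add: reads_cell flag_def\<close>)
      moreover have "?s(A := (2 # l, []), W := (l', []), C := flag False) = ?s"
        using 0 by (auto simp: fun_eq_iff fun_upd_apply)
      ultimately show ?thesis
        using 0 True by (intro exI[of _ "[2]"]) (auto simp: digit_def numeral_3_eq_3)
    qed
  next
    case (Suc k)
    show ?case
    proof (cases "a = [] \<and> w = [] \<and> \<not> c")
      case True
      then show ?thesis
        using Suc.prems halt[of s l l'] by (intro exI[of _ "[]"]) (auto intro: runs_mono)
    next
      case False
      define t where "t = digit (cell a) + digit (cell w) + of_bool c"
      define l2 where "l2 = (if w = [] then l' else cell w # l')"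
      define x :: nat where "x = (if odd t then 2 else 1)"
      let ?s = "s(A := (x # l, tl a), W := (l2, tl w), C := flag (2 \<le> t))"
      have 1: "runs (Atom (add_step A W C)) s 1 ?s"
        using step[OF Suc.prems(1-4) Suc.prems(6) t_def] by (simp add: l2_def x_def)
      have "bits (tl a)" "bits (tl w)" "length (tl a) \<le> k" "length (tl w) \<le> k"
        using Suc.prems by (auto simp: bits_tl)
      then obtain a' where a': "bits a'" "val a' = val (tl a) + val (tl w) + of_bool (2 \<le> t)"
        "length a' \<le> k + 1"
        and 2: "runs ?loop ?s (2 * k + 3)
          (?s(A := (rev a' @ x # l, []), W := (rev (tl w) @ l2, []), C := flag False))"
        using Suc.IH[of ?s "x # l" "tl a" l2 "tl w" "2 \<le> t"] Suc.prems(4) by auto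
      have 3: "runs ?loop s (1 + (2 * k + 3) + 1)
          (?s(A := (rev a' @ x # l, []), W := (rev (tl w) @ l2, []), C := flag False))"
        by (rule runs_Loop_step[OF _ 1 2])
          (use False Suc.prems in \<open>auto simp: reads_cell flag_def cell_eq_0 bits_notin\<close>)
      have "rev (tl w) @ l2 = rev w @ l'"
        by (cases w) (auto simp: l2_def)
      then have "?s(A := (rev a' @ x # l, []), W := (rev (tl w) @ l2, []), C := flag False) =
          s(A := (rev (x # a') @ l, []), W := (rev w @ l', []), C := flag False)"
        using Suc.prems(4) by (auto simp: fun_eq_iff fun_upd_apply)
      moreover have "val (x # a') = val a + val w + of_bool c"
      proof -
        \<comment> \<open>A column sum of at most 3 is represented by one output digit and one carry
          bit.\<close>
        have "t \<le> 3"
          by (simp add: t_def digit_def)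
        then consider "t = 0" | "t = 1" | "t = 2" | "t = 3"
          by linarith
        then have "digit x + 2 * of_bool (2 \<le> t) = t"
          by cases (auto simp: x_def digit_def)
        then show ?thesis
          using val_tl[of a] val_tl[of w] by (simp add: a'(2) t_def)
      qed
      moreover have "bits (x # a')" "length (x # a') \<le> Suc k + 1"
        using a' by (auto simp: x_def)
      ultimately show ?thesis
        using 3 by (intro exI[of _ "x # a'"]) (auto simp: algebra_simps)
    qed
  }
qed

lemma runs_add:
  assumes "s A = ([], a)" "s W = ([], w)" "s C = flag False" "distinct [A, W, C]"
    and "bits a" "bits w" "length a \<le> k" "length w \<le> k"
  shows "\<exists>a'. bits a' \<and> val a' = val a + val w \<and> length a' \<le> k + 1 \<and>
    runs (add A W C) s (6 * k + 17) (s(A := ([], a')))"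
proof -
  obtain a' where a': "bits a'" "val a' = val a + val w" "length a' \<le> k + 1"
    and 1: "runs (Loop (\<lambda>rd. rd A \<noteq> 0 \<or> rd W \<noteq> 0 \<or> rd C \<noteq> 0) (Atom (add_step A W C))) s
      (2 * k + 3) (s(A := (rev a', []), W := (rev w, []), C := flag False))"
      (is "runs _ _ _ ?s")
    using runs_add_loop[OF assms] by auto
  have 2: "runs (rewind {0} A) ?s (2 * length a' + 5) (?s(A := ([], a')))"
    using runs_rewind[of ?s A "rev a'" "[]" "[]" "{0}"] assms(4) a'(1) by (simp add: bits_notin)
  have 3: "runs (rewind {0} W) (?s(A := ([], a'))) (2 * length w + 5) (s(A := ([], a')))"
    by (rule runs_eq[OF runs_rewind[of _ _ "rev w" "[]" "[]"]])
      (use assms in \<open>auto simp: bits_notin fun_eq_iff fun_upd_apply\<close>)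
  have "runs (add A W C) s (6 * k + 17) (s(A := ([], a')))"
    unfolding add_def using runs_Seq[OF 1 runs_Seq[OF 2 3]]
    by (rule runs_mono) (use a'(3) assms(8) in simp)
  with a' show ?thesis
    by blast
qed

section \<open>Multiplication and signed multiply-add\<close>

definition mul_body :: "'r \<Rightarrow> 'r \<Rightarrow> 'r \<Rightarrow> 'r \<Rightarrow> 'r com" where
  "mul_body X W C A =
     Cond (\<lambda>rd. rd X = 2) (add A W C) (Atom (\<lambda>_. Map.empty)) ;;
     left W ;; put W 1 ;; right X"

definition mul :: "'r \<Rightarrow> 'r \<Rightarrow> 'r \<Rightarrow> 'r \<Rightarrow> 'r com" where
  "mul X W C A = Loop (\<lambda>rd. rd X = 1 \<or> rd X = 2) (mul_body X W C A)"

text \<open>Shift-and-add. Since tapes extend to the left and the least significant digit comes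
  first, \<open>W\<close> is doubled in constant time by writing the digit 0, symbol 1, in front of
  it.\<close>

lemma runs_mul_body:
  assumes "s X = (l, d # x)" "s A = ([], a)" "s W = ([], w)" "s C = flag False"
    and "distinct [X, W, C, A]" "d = 1 \<or> d = 2" "bits a" "bits w" "length a \<le> k" "length w \<le> k"
  shows "\<exists>a'. bits a' \<and> val a' = val a + val w * digit d \<and> length a' \<le> k + 1 \<and>
    runs (mul_body X W C A) s (6 * k + 24) (s(X := (d # l, x), A := ([], a'), W := ([], 1 # w)))"
proof -
  obtain a' where a': "bits a'" "val a' = val a + val w * digit d" "length a' \<le> k + 1"
    and 1: "runs (if reads s X = 2 then add A W C else Atom (\<lambda>_. Map.empty)) s (6 * k + 17)
      (s(A := ([], a')))"
  proof (cases "d = 2")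
    case True
    then show thesis
      using runs_add[of s A a W w C k] assms that by (auto simp: digit_def reads_cell)
  next
    case False
    have "runs (Atom (\<lambda>_. Map.empty)) s 1 (s(A := ([], a)))"
      using assms by (intro runs_Atom) (auto simp: fun_eq_iff fun_upd_apply)
    then have "runs (Atom (\<lambda>_. Map.empty)) s (6 * k + 17) (s(A := ([], a)))"
      by (rule runs_mono) simp
    with False show thesis
      using assms that[of a] by (auto simp: digit_def reads_cell)
  qed
  let ?s = "s(A := ([], a'))"
  have 2: "runs (left W) ?s 1 (?s(W := ([], scons 0 w)))"
    using runs_left[of ?s W "[]" w] assms by (simp add: bits_notin)
  have 3: "runs (put W 1) (?s(W := ([], scons 0 w))) 1 (?s(W := ([], 1 # w)))"
    using runs_put[of "?s(W := ([], scons 0 w))" W "[]" "scons 0 w" 1] by simp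
  have "runs (right X) (?s(W := ([], 1 # w))) 1 (?s(W := ([], 1 # w), X := (d # l, x)))"
    using runs_right[of "?s(W := ([], 1 # w))" X l "d # x"] assms by auto
  moreover have "?s(W := ([], 1 # w), X := (d # l, x)) =
      s(X := (d # l, x), A := ([], a'), W := ([], 1 # w))"
    using assms(5) by (auto simp: fun_eq_iff fun_upd_apply)
  ultimately have 4: "runs (right X) (?s(W := ([], 1 # w))) 1
      (s(X := (d # l, x), A := ([], a'), W := ([], 1 # w)))"
    by simp
  have "runs (mul_body X W C A) s (6 * k + 24)
      (s(X := (d # l, x), A := ([], a'), W := ([], 1 # w)))"
    unfolding mul_body_def using runs_Seq[OF runs_Cond[where Q = "\<lambda>rd. rd X = 2", OF 1] runs_Seq[OF 2 runs_Seq[OF 3 4]]]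
    by (rule runs_mono) simp
  with a' show ?thesis
    by blast
qed

text \<open>Each digit of \<open>x\<close> lengthens \<open>W\<close>, and possibly the accumulator,
  by one. The local bound \<open>k\<close> therefore increases along the induction, while
  \<open>K\<close> bounds it throughout and gives every digit the same cost.\<close>

lemma runs_mul:
  assumes "s X = (l, x @ r)" "s A = ([], a)" "s W = ([], w)" "s C = flag False"
    and "distinct [X, W, C, A]" "bits x" "bits a" "bits w" "cell r \<noteq> 1" "cell r \<noteq> 2"
    and "length a \<le> k" "length w \<le> k" "k + length x \<le> K"
  shows "\<exists>a' w'. bits a' \<and> val a' = val a + val w * val x \<and> length a' \<le> k + length x \<and>
    bits w' \<and> length w' \<le> k + length x \<and>
    runs (mul X W C A) s (length x * (6 * K + 25) + 1)
      (s(X := (rev x @ l, r), A := ([], a'), W := ([], w')))"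
  using assms
proof (induction x arbitrary: s l a w k)
  case Nil
  then have "s(X := (l, r), A := ([], a), W := ([], w)) = s"
    by (auto simp: fun_eq_iff fun_upd_apply)
  moreover have "runs (mul X W C A) s 1 s"
    unfolding mul_def using Nil by (intro runs_Loop_done) (simp add: reads_cell)
  ultimately show ?case
    using Nil by (intro exI[of _ a] exI[of _ w]) auto
next
  case (Cons d x)
  obtain a1 where a1: "bits a1" "val a1 = val a + val w * digit d" "length a1 \<le> k + 1"
    and 1: "runs (mul_body X W C A) s (6 * k + 24)
      (s(X := (d # l, x @ r), A := ([], a1), W := ([], 1 # w)))" (is "runs _ _ _ ?s")
    using runs_mul_body[of s X l d "x @ r" A a W w C k] Cons.prems by auto
  obtain a' w' where a': "bits a'" "val a' = val a1 + val (1 # w) * val x"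
      "length a' \<le> k + 1 + length x" "bits w'" "length w' \<le> k + 1 + length x"
    and 2: "runs (mul X W C A) ?s (length x * (6 * K + 25) + 1)
      (?s(X := (rev x @ d # l, r), A := ([], a'), W := ([], w')))" (is "runs _ _ _ ?s'")
    using Cons.IH[of ?s "d # l" a1 "1 # w" "k + 1"] Cons.prems a1 by auto
  have 3: "runs (mul X W C A) s ((6 * k + 24) + (length x * (6 * K + 25) + 1) + 1) ?s'"
    unfolding mul_def
    by (rule runs_Loop_step[OF _ 1 2[unfolded mul_def]]) (use Cons.prems in \<open>auto simp: reads_cell\<close>)
  have "?s' = s(X := (rev (d # x) @ l, r), A := ([], a'), W := ([], w'))"
    using Cons.prems(5) by (auto simp: fun_eq_iff fun_upd_apply)
  with runs_mono[OF 3, of "length (d # x) * (6 * K + 25) + 1"] Cons.prems(13)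
  have "runs (mul X W C A) s (length (d # x) * (6 * K + 25) + 1)
      (s(X := (rev (d # x) @ l, r), A := ([], a'), W := ([], w')))"
    by simp
  moreover have "val a' = val a + val w * val (d # x)"
    using a'(2) a1(2) by (simp add: digit_def algebra_simps)
  ultimately show ?case
    using a' by (intro exI[of _ a'] exI[of _ w']) auto
qed

abbreviation nop :: "'r com" where
  "nop \<equiv> Atom (\<lambda>_. Map.empty)"

lemma runs_nop: "runs nop s 1 s"
  by (rule runs_Atom) simp

text \<open>Rewinding \<open>X\<close> to the start of its entry keeps the scoring vector reusable,
  and clearing \<open>W\<close> makes room for the next weight.\<close>

definition muladd :: "'r \<Rightarrow> 'r \<Rightarrow> 'r \<Rightarrow> 'r \<Rightarrow> 'r \<Rightarrow> 'r com" where
  "muladd X W C A B =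
     Cond (\<lambda>rd. rd X = 3) (right X ;; mul X W C B) (mul X W C A) ;; rewind {0, 4} X ;; clear W"

lemma encode_int_notin: "0 \<notin> set (encode_int x)" "4 \<notin> set (encode_int x)" "5 \<notin> set (encode_int x)"
  using bits_encode_nat[of "nat \<bar>x\<bar>"] by (auto simp: encode_int_def bits_def)

lemma runs_muladd:
  assumes "s X = (l, encode_int x @ 4 # r)" "0 \<notin> set l" "0 \<notin> set r" "cell l \<in> {0, 4}"
    and "s A = ([], a)" "s B = ([], b)" "s W = ([], w)" "s C = flag False"
    and "distinct [X, W, C, A, B]" "bits a" "bits b" "bits w"
    and "length a \<le> k" "length b \<le> k" "length w \<le> k" "length (encode_int x) \<le> n" "k + n < N"
  shows "\<exists>a' b'. bits a' \<and> bits b' \<and>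
    int (val a') - int (val b') = int (val a) - int (val b) + int (val w) * x \<and>
    length a' \<le> k + n \<and> length b' \<le> k + n \<and>
    runs (muladd X W C A B) s (65 * (N * N)) (s(A := ([], a'), B := ([], b'), W := ([], [])))"
proof -
  define y where "y = encode_nat (nat \<bar>x\<bar>)"
  have y: "bits y" "val y = nat \<bar>x\<bar>" "encode_int x = (if x < 0 then [3] else []) @ y"
    by (simp_all add: y_def bits_encode_nat val_encode_nat encode_int_def)
  have ly: "length y \<le> n"
    using assms(16) by (simp add: y(3) split: if_splits)
  \<comment> \<open>\<open>runs_mul\<close> contributes one transition besides the product; the
    other two pay for stepping over the minus sign.\<close>
  define tm where "tm = length y * (6 * N + 25) + 3"
  obtain a' b' w' where ab: "bits a'" "bits b'" "length a' \<le> k + n" "length b' \<le> k + n"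
      "int (val a') - int (val b') = int (val a) - int (val b) + int (val w) * x"
      "bits w'" "length w' \<le> k + n"
    and 1: "runs (if reads s X = 3 then right X ;; mul X W C B else mul X W C A) s tm
      (s(X := (rev (encode_int x) @ l, 4 # r), A := ([], a'), B := ([], b'), W := ([], w')))"
  proof (cases "x < 0")
    case True
    let ?s = "s(X := (3 # l, y @ 4 # r))"
    have 1: "runs (right X) s 1 ?s"
      by (rule runs_eq[OF runs_right]) (use assms True y in auto)
    have "\<exists>b' w'. bits b' \<and> val b' = val b + val w * val y \<and> length b' \<le> k + length y \<and>
        bits w' \<and> length w' \<le> k + length y \<and>
        runs (mul X W C B) ?s (length y * (6 * N + 25) + 1)
          (?s(X := (rev y @ 3 # l, 4 # r), B := ([], b'), W := ([], w')))"
      by (rule runs_mul[where r = "4 # r"]) (use assms y ly in auto)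
    then obtain b' w' where b': "bits b'" "val b' = val b + val w * val y"
        "length b' \<le> k + length y" "bits w'" "length w' \<le> k + length y"
      and 2: "runs (mul X W C B) ?s (length y * (6 * N + 25) + 1)
          (?s(X := (rev y @ 3 # l, 4 # r), B := ([], b'), W := ([], w')))"
      by blast
    have "runs (right X ;; mul X W C B) s tm
      (s(X := (rev (encode_int x) @ l, 4 # r), A := ([], a), B := ([], b'), W := ([], w')))"
      by (rule runs_eq[OF runs_Seq[OF 1 2]])
        (use True assms y in \<open>auto simp: tm_def fun_eq_iff fun_upd_apply\<close>)
    with that[of a b' w'] b' assms True y ly show thesis
      by (auto simp: reads_cell)
  next
    case False
    have "cell (y @ 4 # r) \<noteq> 3"
      using y(1) by (cases y) auto
    have "\<exists>a' w'. bits a' \<and> val a' = val a + val w * val y \<and> length a' \<le> k + length y \<and>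
        bits w' \<and> length w' \<le> k + length y \<and>
        runs (mul X W C A) s (length y * (6 * N + 25) + 1)
          (s(X := (rev y @ l, 4 # r), A := ([], a'), W := ([], w')))"
      by (rule runs_mul[where r = "4 # r"]) (use False assms y ly in auto)
    then obtain a' w' where a': "bits a'" "val a' = val a + val w * val y"
        "length a' \<le> k + length y" "bits w'" "length w' \<le> k + length y"
      and 2: "runs (mul X W C A) s (length y * (6 * N + 25) + 1)
          (s(X := (rev y @ l, 4 # r), A := ([], a'), W := ([], w')))"
      by blast
    have "runs (mul X W C A) s tm
      (s(X := (rev (encode_int x) @ l, 4 # r), A := ([], a'), B := ([], b), W := ([], w')))"
      by (rule runs_eq[OF 2])
        (use False assms y in \<open>auto simp: tm_def fun_eq_iff fun_upd_apply\<close>)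
    with that[of a' b w'] a' assms False y ly \<open>cell (y @ 4 # r) \<noteq> 3\<close> show thesis
      by (auto simp: reads_cell)
  qed
  let ?s = "s(X := (rev (encode_int x) @ l, 4 # r), A := ([], a'), B := ([], b'), W := ([], w'))"
  let ?t = "s(A := ([], a'), B := ([], b'), W := ([], w'))"
  have 2: "runs (rewind {0, 4} X) ?s (2 * n + 5) ?t"
    by (rule runs_eq[OF runs_rewind[of _ _ "rev (encode_int x)" l "4 # r"]])
      (use assms in \<open>auto simp: encode_int_notin fun_eq_iff fun_upd_apply\<close>)
  have 3: "runs (clear W) ?t (2 * N + 1) (s(A := ([], a'), B := ([], b'), W := ([], [])))"
    by (rule runs_eq[OF runs_clear[of _ _ w']]) (use ab assms in \<open>auto simp: bits_notin\<close>)
  have "length y * (6 * N + 25) \<le> N * (6 * N + 25)"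
    using ly assms(17) by (intro mult_le_mono1) simp
  also have "\<dots> = 6 * (N * N) + 25 * N"
    by (simp add: algebra_simps)
  finally have "tm \<le> 6 * (N * N) + 25 * N + 3"
    by (simp add: tm_def)
  moreover have "N \<le> N * N"
    by (rule le_square)
  ultimately have "(tm + 1) + ((2 * n + 5) + (2 * N + 1) + 1) + 1 \<le> 65 * (N * N)"
    using assms(17) by linarith
  with runs_Seq[OF runs_Cond[where Q = "\<lambda>rd. rd X = 3", OF 1] runs_Seq[OF 2 3]]
  have "runs (muladd X W C A B) s (65 * (N * N)) (s(A := ([], a'), B := ([], b'), W := ([], [])))"
    unfolding muladd_def by (rule runs_mono)
  with ab show ?thesis
    by blast
qed

section \<open>Comparison\<close>

definition compare_step :: "'r \<Rightarrow> 'r \<Rightarrow> 'r \<Rightarrow> ('r \<Rightarrow> nat) \<Rightarrow> 'r \<rightharpoonup> nat \<times> move" where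
  "compare_step A B G rd =
     [A \<mapsto> (rd A, if rd A = 0 then Stay else Right),
      B \<mapsto> (rd B, if rd B = 0 then Stay else Right),
      G \<mapsto> (if digit (rd A) = digit (rd B) then rd G
            else if digit (rd B) < digit (rd A) then 2 else 0, Stay)]"

text \<open>\<open>R\<close> is set but never reset, so it collects a disjunction over successive
  calls. \<open>clear\<close> erases only to the right, which is why both words are rewound before
  they are removed for the next round.\<close>

definition compare :: "'r \<Rightarrow> 'r \<Rightarrow> 'r \<Rightarrow> 'r \<Rightarrow> 'r com" where
  "compare A B G R =
     Loop (\<lambda>rd. rd A \<noteq> 0 \<or> rd B \<noteq> 0) (Atom (compare_step A B G)) ;;
     Cond (\<lambda>rd. rd G = 2) (put R 2) nop ;; put G 0 ;;
     rewind {0} A ;; rewind {0} B ;; clear A ;; clear B"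

text \<open>The least significant digit is read first, so the last differing column decides: the
  verdict \<open>g\<close> of the columns already read survives only if the remaining words have
  equal values.\<close>

lemma runs_compare_loop:
  assumes "s A = (l, a)" "s B = (l', b)" "s G = flag g" "distinct [A, B, G]"
    and "bits a" "bits b" "length a \<le> k" "length b \<le> k"
  shows "runs (Loop (\<lambda>rd. rd A \<noteq> 0 \<or> rd B \<noteq> 0) (Atom (compare_step A B G))) s (2 * k + 1)
    (s(A := (rev a @ l, []), B := (rev b @ l', []),
       G := flag (val b < val a \<or> val a = val b \<and> g)))"
    (is "runs ?loop _ _ _")
  using assms
proof (induction k arbitrary: s l a l' b g)
  case 0
  then show ?case
    by (intro runs_eq[OF runs_Loop_done]) (auto simp: reads_cell fun_eq_iff fun_upd_apply)
next
  case (Suc k)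
  show ?case
  proof (cases "a = [] \<and> b = []")
    case True
    with Suc.prems show ?thesis
      by (intro runs_eq[OF runs_Loop_done]) (auto simp: reads_cell fun_eq_iff fun_upd_apply)
  next
    case False
    define g' where "g' = (digit (cell b) < digit (cell a) \<or> digit (cell a) = digit (cell b) \<and> g)"
    let ?s = "s(A := (if a = [] then l else cell a # l, tl a),
      B := (if b = [] then l' else cell b # l', tl b), G := flag g')"
    have 1: "runs (Atom (compare_step A B G)) s 1 ?s"
      using Suc.prems
      by (intro runs_Atom) (cases a; cases b;
        auto simp: reads_cell compare_step_def flag_def g'_def digit_def fun_eq_iff fun_upd_apply)
    have 2: "runs ?loop ?s (2 * k + 1)
      (s(A := (rev a @ l, []), B := (rev b @ l', []),
         G := flag (val b < val a \<or> val a = val b \<and> g)))"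
    proof (rule runs_eq[OF Suc.IH])
      show "?s A = (if a = [] then l else cell a # l, tl a)"
        "?s B = (if b = [] then l' else cell b # l', tl b)" "?s G = flag g'"
        using Suc.prems by auto
      have "(val (tl b) < val (tl a) \<or> val (tl a) = val (tl b) \<and> g') \<longleftrightarrow>
          (val b < val a \<or> val a = val b \<and> g)"
        using val_tl[of a] val_tl[of b] unfolding g'_def by (auto simp: digit_def split: if_splits)
      then show "?s(A := (rev (tl a) @ (if a = [] then l else cell a # l), []),
          B := (rev (tl b) @ (if b = [] then l' else cell b # l'), []),
          G := flag (val (tl b) < val (tl a) \<or> val (tl a) = val (tl b) \<and> g')) =
        s(A := (rev a @ l, []), B := (rev b @ l', []),
          G := flag (val b < val a \<or> val a = val b \<and> g))"
        using Suc.prems(4) by (cases a; cases b; auto simp: fun_eq_iff fun_upd_apply)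
    qed (use Suc.prems in \<open>auto simp: bits_tl\<close>)
    have "reads s A \<noteq> 0 \<or> reads s B \<noteq> 0"
      using False Suc.prems by (auto simp: reads_cell cell_eq_0 bits_notin)
    from runs_Loop_step[of "\<lambda>rd. rd A \<noteq> 0 \<or> rd B \<noteq> 0", OF this 1 2] show ?thesis
      by (rule runs_mono) simp
  qed
qed

lemma runs_compare:
  assumes "s A = ([], a)" "s B = ([], b)" "s G = flag False" "s R = flag q" "distinct [A, B, G, R]"
    and "bits a" "bits b" "length a \<le> k" "length b \<le> k"
  shows "runs (compare A B G R) s (10 * k + 30)
    (s(A := ([], []), B := ([], []), R := flag (q \<or> val b < val a)))"
proof -
  let ?s1 = "s(A := (rev a, []), B := (rev b, []), G := flag (val b < val a))"
  have 1: "runs (Loop (\<lambda>rd. rd A \<noteq> 0 \<or> rd B \<noteq> 0) (Atom (compare_step A B G))) s (2 * k + 1) ?s1"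
    by (rule runs_eq[OF runs_compare_loop[of s A "[]" a B "[]" b G False k]]) (use assms in auto)
  let ?s2 = "?s1(R := flag (q \<or> val b < val a))"
  have 2: "runs (if reads ?s1 G = 2 then put R 2 else nop) ?s1 1 ?s2"
  proof (cases "val b < val a")
    case True
    have "runs (put R 2) ?s1 1 ?s2"
      by (rule runs_eq[OF runs_put[of _ _ "[]" "if q then [2] else []"]])
        (use assms True in \<open>auto simp: flag_def fun_eq_iff fun_upd_apply\<close>)
    with True show ?thesis
      by (simp add: reads_def flag_def)
  next
    case False
    then have "(if reads ?s1 G = 2 then put R 2 else nop) = nop"
      by (simp add: reads_def flag_def)
    then show ?thesis
      by (simp only:, intro runs_eq[OF runs_nop])
        (use False assms in \<open>auto simp: fun_eq_iff fun_upd_apply\<close>)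
  qed
  let ?s3 = "s(A := (rev a, []), B := (rev b, []), R := flag (q \<or> val b < val a))"
  have 3: "runs (put G 0) ?s2 1 ?s3"
    by (rule runs_eq[OF runs_put[of _ _ "[]" "if val b < val a then [2] else []"]])
      (use assms in \<open>auto simp: flag_def fun_eq_iff fun_upd_apply\<close>)
  let ?s4 = "s(A := ([], a), B := (rev b, []), R := flag (q \<or> val b < val a))"
  have 4: "runs (rewind {0} A) ?s3 (2 * k + 5) ?s4"
    by (rule runs_eq[OF runs_rewind[of _ _ "rev a" "[]" "[]"]])
      (use assms in \<open>auto simp: bits_notin fun_eq_iff fun_upd_apply\<close>)
  let ?s5 = "s(A := ([], a), B := ([], b), R := flag (q \<or> val b < val a))"
  have 5: "runs (rewind {0} B) ?s4 (2 * k + 5) ?s5"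
    by (rule runs_eq[OF runs_rewind[of _ _ "rev b" "[]" "[]"]])
      (use assms in \<open>auto simp: bits_notin fun_eq_iff fun_upd_apply\<close>)
  let ?s6 = "s(A := ([], []), B := ([], b), R := flag (q \<or> val b < val a))"
  have 6: "runs (clear A) ?s5 (2 * k + 1) ?s6"
    by (rule runs_eq[OF runs_clear[of _ _ a]])
      (use assms in \<open>auto simp: bits_notin fun_eq_iff fun_upd_apply\<close>)
  have 7: "runs (clear B) ?s6 (2 * k + 1)
      (s(A := ([], []), B := ([], []), R := flag (q \<or> val b < val a)))"
    by (rule runs_eq[OF runs_clear[of _ _ b]])
      (use assms in \<open>auto simp: bits_notin fun_eq_iff fun_upd_apply\<close>)
  show ?thesis
    unfolding compare_def
    using runs_Seq[OF 1 runs_Seq[OF runs_Cond[where Q = "\<lambda>rd. rd G = 2", OF 2]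
      runs_Seq[OF 3 runs_Seq[OF 4 runs_Seq[OF 5 runs_Seq[OF 6 7]]]]]]
    by (rule runs_mono) simp
qed

section \<open>Counting and matching of candidate names\<close>

fun succ :: "nat list \<Rightarrow> nat list" where
  "succ [] = [2]"
| "succ (a # l) = (if a = 2 then 1 # succ l else 2 # l)"

text \<open>Candidate names are compared symbol by symbol, not by value, so the counter must produce
  the normalized word; \<open>runs_add\<close> would guarantee only its value.\<close>

lemma succ_encode_nat: "succ (encode_nat n) = encode_nat (Suc n)"
proof (induction n rule: encode_nat.induct)
  case (1 n)
  show ?case
  proof (cases "n = 0")
    case True
    then show ?thesis
      by (simp add: encode_nat.simps[of 0] encode_nat.simps[of "Suc 0"])
  next
    case False
    then have "succ (encode_nat (n div 2)) = encode_nat (Suc (n div 2))"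
      by (rule 1)
    with False show ?thesis
      by (subst (1 2) encode_nat.simps) auto
  qed
qed

definition increment :: "'r \<Rightarrow> 'r com" where
  "increment D =
     (Loop (\<lambda>rd. rd D = 2) (Atom (\<lambda>_. [D \<mapsto> (1, Right)])) ;; put D 2) ;; rewind {0} D"

lemma runs_increment_scan:
  assumes "s D = (l, x)" "bits x" "bits l"
  shows "\<exists>l' r'. rev l' @ r' = rev l @ succ x \<and> bits l' \<and> bits r' \<and>
    length l' \<le> length l + length x \<and>
    runs (Loop (\<lambda>rd. rd D = 2) (Atom (\<lambda>_. [D \<mapsto> (1, Right)])) ;; put D 2) s (2 * length x + 3)
      (s(D := (l', r')))"
proof -
  \<comment> \<open>When the carry stops, the scanned symbol is a 1 or the blank after the word;
    either is replaced by 2, hence \<open>2 # tl r'\<close>.\<close>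
  have "\<exists>l' r'. rev l' @ 2 # tl r' = rev l @ succ x \<and> bits l' \<and> bits r' \<and>
      length l' \<le> length l + length x \<and>
      runs (Loop (\<lambda>rd. rd D = 2) (Atom (\<lambda>_. [D \<mapsto> (1, Right)]))) s (2 * length x + 1)
        (s(D := (l', r')))"
    using assms
  proof (induction x arbitrary: s l)
    case Nil
    then have "runs (Loop (\<lambda>rd. rd D = 2) (Atom (\<lambda>_. [D \<mapsto> (1, Right)]))) s 1 (s(D := (l, [])))"
      by (intro runs_eq[OF runs_Loop_done]) (auto simp: reads_cell fun_eq_iff fun_upd_apply)
    with Nil show ?case
      by (intro exI[of _ l] exI[of _ "[]"]) auto
  next
    case (Cons a x)
    show ?case
    proof (cases "a = 2")
      case False
      then have "runs (Loop (\<lambda>rd. rd D = 2) (Atom (\<lambda>_. [D \<mapsto> (1, Right)]))) s (2 * length (a # x) + 1)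
          (s(D := (l, a # x)))"
        using Cons.prems
        by (intro runs_eq[OF runs_Loop_done]) (auto simp: reads_cell fun_eq_iff fun_upd_apply)
      with Cons.prems False show ?thesis
        by (intro exI[of _ l] exI[of _ "a # x"]) auto
    next
      case True
      let ?s = "s(D := (1 # l, x))"
      have 1: "runs (Atom (\<lambda>_. [D \<mapsto> (1, Right)])) s 1 ?s"
        using Cons.prems by (intro runs_Atom) auto
      obtain l' r' where *: "rev l' @ 2 # tl r' = rev (1 # l) @ succ x" "bits l'" "bits r'"
          "length l' \<le> length (1 # l) + length x"
        and 2: "runs (Loop (\<lambda>rd. rd D = 2) (Atom (\<lambda>_. [D \<mapsto> (1, Right)]))) ?s (2 * length x + 1)
          (?s(D := (l', r')))"
        using Cons.IH[of ?s "1 # l"] Cons.prems by auto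
      have "reads s D = 2"
        using True Cons.prems by (simp add: reads_cell)
      from runs_Loop_step[of "\<lambda>rd. rd D = 2", OF this 1 2]
      have "runs (Loop (\<lambda>rd. rd D = 2) (Atom (\<lambda>_. [D \<mapsto> (1, Right)]))) s (2 * length (a # x) + 1)
          (s(D := (l', r')))"
        by (rule runs_eq) auto
      with * True show ?thesis
        by (intro exI[of _ l'] exI[of _ r']) auto
    qed
  qed
  then obtain l' r' where *: "rev l' @ 2 # tl r' = rev l @ succ x" "bits l'" "bits r'"
      "length l' \<le> length l + length x"
    and 1: "runs (Loop (\<lambda>rd. rd D = 2) (Atom (\<lambda>_. [D \<mapsto> (1, Right)]))) s (2 * length x + 1)
      (s(D := (l', r')))"
    by blast
  have 2: "runs (put D 2) (s(D := (l', r'))) 1 (s(D := (l', 2 # tl r')))"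
    by (rule runs_eq[OF runs_put]) auto
  have "runs (Loop (\<lambda>rd. rd D = 2) (Atom (\<lambda>_. [D \<mapsto> (1, Right)])) ;; put D 2) s (2 * length x + 3)
      (s(D := (l', 2 # tl r')))"
    using runs_Seq[OF 1 2] by (rule runs_mono) simp
  with * show ?thesis
    by (intro exI[of _ l'] exI[of _ "2 # tl r'"]) (auto simp: bits_tl)
qed

lemma runs_increment:
  assumes "s D = ([], encode_nat d)"
  shows "runs (increment D) s (4 * length (encode_nat d) + 10) (s(D := ([], encode_nat (Suc d))))"
proof -
  obtain l r where lr: "rev l @ r = succ (encode_nat d)" "bits l" "bits r"
      "length l \<le> length (encode_nat d)"
    and 1: "runs (Loop (\<lambda>rd. rd D = 2) (Atom (\<lambda>_. [D \<mapsto> (1, Right)])) ;; put D 2) s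
      (2 * length (encode_nat d) + 3) (s(D := (l, r)))"
    using runs_increment_scan[of s D "[]" "encode_nat d"] assms by (auto simp: bits_encode_nat)
  have 2: "runs (rewind {0} D) (s(D := (l, r))) (2 * length l + 5) (s(D := ([], encode_nat (Suc d))))"
    by (rule runs_eq[OF runs_rewind[of _ _ l "[]" r]])
      (use lr in \<open>auto simp: bits_notin succ_encode_nat\<close>)
  show ?thesis
    unfolding increment_def using runs_Seq[OF 1 2] by (rule runs_mono) (use lr(4) in simp)
qed

definition match :: "'r \<Rightarrow> 'r \<Rightarrow> 'r com" where
  "match i j = Loop (\<lambda>rd. rd i \<noteq> 4 \<and> rd i = rd j) (Atom (\<lambda>rd. [i \<mapsto> (rd i, Right), j \<mapsto> (rd j, Right)]))"

text \<open>\<open>u\<close> is the common prefix. The words agree exactly if the scan ends at the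
  end of both, with the terminator 4 under one head and a blank under the other.\<close>

lemma runs_match:
  assumes "s i = (l, x @ 4 # r)" "s j = (l', y)" "i \<noteq> j" "bits x" "bits y"
  shows "\<exists>u x' y'. x = u @ x' \<and> y = u @ y' \<and> (cell (x' @ 4 # r) = 4 \<and> cell y' = 0 \<longleftrightarrow> x = y) \<and>
    runs (match i j) s (2 * length x + 1) (s(i := (rev u @ l, x' @ 4 # r), j := (rev u @ l', y')))"
  using assms
proof (induction x arbitrary: s l l' y)
  case Nil
  then have "runs (match i j) s (2 * length ([] :: nat list) + 1)
      (s(i := (rev [] @ l, [] @ 4 # r), j := (rev [] @ l', y)))"
    unfolding match_def
    by (intro runs_eq[OF runs_Loop_done]) (auto simp: reads_cell fun_eq_iff fun_upd_apply)
  with Nil show ?case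
    by (intro exI[of _ "[]"] exI[of _ y]) (auto simp: cell_eq_0 bits_notin)
next
  case (Cons a x)
  show ?case
  proof (cases "cell y = a")
    case False
    then have "runs (match i j) s (2 * length (a # x) + 1)
        (s(i := (rev [] @ l, (a # x) @ 4 # r), j := (rev [] @ l', y)))"
      using Cons.prems unfolding match_def
      by (intro runs_eq[OF runs_Loop_done]) (auto simp: reads_cell fun_eq_iff fun_upd_apply)
    moreover have "a \<noteq> 4" "a # x \<noteq> y"
      using False Cons.prems by auto
    ultimately show ?thesis
      by (intro exI[of _ "[]"] exI[of _ "a # x"] exI[of _ y]) auto
  next
    case True
    then obtain y1 where y: "y = a # y1"
      using Cons.prems by (cases y) auto
    let ?s = "s(i := (a # l, x @ 4 # r), j := (a # l', y1))"
    have 1: "runs (Atom (\<lambda>rd. [i \<mapsto> (rd i, Right), j \<mapsto> (rd j, Right)])) s 1 ?s"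
      using Cons.prems y by (intro runs_Atom) (auto simp: reads_cell)
    have "\<exists>u x' y'. x = u @ x' \<and> y1 = u @ y' \<and>
        (cell (x' @ 4 # r) = 4 \<and> cell y' = 0 \<longleftrightarrow> x = y1) \<and>
        runs (match i j) ?s (2 * length x + 1)
          (?s(i := (rev u @ a # l, x' @ 4 # r), j := (rev u @ a # l', y')))"
      by (rule Cons.IH) (use Cons.prems y in auto)
    then obtain u x' y' where *: "x = u @ x'" "y1 = u @ y'"
        "cell (x' @ 4 # r) = 4 \<and> cell y' = 0 \<longleftrightarrow> x = y1"
      and 2: "runs (match i j) ?s (2 * length x + 1)
        (?s(i := (rev u @ a # l, x' @ 4 # r), j := (rev u @ a # l', y')))"
      by blast
    have "reads s i \<noteq> 4 \<and> reads s i = reads s j"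
      using Cons.prems y by (auto simp: reads_cell)
    from runs_Loop_step[of "\<lambda>rd. rd i \<noteq> 4 \<and> rd i = rd j", OF this 1 2[unfolded match_def]]
    have "runs (match i j) s (2 * length (a # x) + 1)
        (s(i := (rev (a # u) @ l, x' @ 4 # r), j := (rev (a # u) @ l', y')))"
      unfolding match_def by (rule runs_eq) (use Cons.prems in \<open>auto simp: fun_eq_iff fun_upd_apply\<close>)
    with * y show ?thesis
      by (intro exI[of _ "a # u"] exI[of _ x'] exI[of _ y']) auto
  qed
qed

section \<open>Scoring a candidate\<close>

text \<open>
  \<open>Inp\<close> holds the input; \<open>Alp\<close>, \<open>Las\<close> and \<open>Cnt\<close> hold copies of the scoring vector, where the head
  of \<open>Las\<close> rests on the last entry and that of \<open>Cnt\<close> advances with the candidate \<open>Cand\<close> compared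
  to \<open>Pref\<close>. \<open>Acc\<close> and \<open>Bcc\<close> are the accumulators, \<open>Wt\<close> the weight of the current vote, \<open>Car\<close> a
  carry, \<open>Flg\<close> a flag, and \<open>Res\<close> becomes nonblank once some candidate beats the preferred one.
\<close>

datatype role = Inp | Alp | Las | Cnt | Pref | Cand | Acc | Bcc | Wt | Car | Flg | Res

text \<open>Without the closing 5 the encoding is a homomorphism for \<open>@\<close>, so a head
  resting between two entries splits the list.\<close>

definition entries :: "('a \<Rightarrow> nat list) \<Rightarrow> 'a list \<Rightarrow> nat list" where
  "entries enc xs = concat (map (\<lambda>x. enc x @ [4]) xs)"

lemma entries_simps [simp]:
  "entries enc [] = []"
  "entries enc (x # xs) = enc x @ 4 # entries enc xs"
  "entries enc (xs @ ys) = entries enc xs @ entries enc ys"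
  by (simp_all add: entries_def)

lemma encode_list_entries: "encode_list enc xs = entries enc xs @ [5]"
  by (simp add: encode_list_def entries_def)

lemma length_le_entries: "length xs \<le> length (entries enc xs)"
  by (induction xs) auto

lemma notin_entries: "a \<noteq> 4 \<Longrightarrow> (\<And>x. a \<notin> set (enc x)) \<Longrightarrow> a \<notin> set (entries enc xs)"
  by (auto simp: entries_def)

lemma encode_nat_notin: "0 \<notin> set (encode_nat x)" "4 \<notin> set (encode_nat x)" "5 \<notin> set (encode_nat x)"
  using bits_encode_nat[of x] by (auto simp: bits_def)

lemmas nat_entries_notin = notin_entries[of 0 encode_nat] notin_entries[of 5 encode_nat]
lemmas int_entries_notin = notin_entries[of 0 encode_int] notin_entries[of 5 encode_int]

lemmas word_simps = encode_nat_notin encode_int_notin nat_entries_notin int_entries_notin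

text \<open>Skipping to the closing 5 on a hit makes the loop of \<open>lookup\<close> stop there as
  well; the outcome is recorded by \<open>Flg\<close> alone.\<close>

definition lookup_step :: "role \<Rightarrow> role com" where
  "lookup_step c =
     match Inp c ;;
     Cond (\<lambda>rd. rd Inp = 4 \<and> rd c = 0)
       (put Flg 2 ;; skip {5} Inp)
       (skip {4} Inp ;; right Inp ;; skip {4} Alp ;; right Alp) ;;
     rewind {0} c"

text \<open>On a hit, the head of \<open>Alp\<close> is left on the entry of the scoring vector for the position found.\<close>

definition lookup :: "role \<Rightarrow> role com" where
  "lookup c = Loop (\<lambda>rd. rd Inp \<noteq> 5) (lookup_step c)"

lemma runs_lookup_step_hit:
  assumes "s Inp = (l, encode_nat d @ 4 # entries encode_nat v @ 5 # r)"
    and "s c = ([], encode_nat d)" "s Flg = flag False" "c \<notin> {Inp, Alp, Flg}"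
    and "length (entries encode_nat (d # v)) \<le> n"
  shows "runs (lookup_step c) s (8 * n + 20)
    (s(Inp := (rev (entries encode_nat (d # v)) @ l, 5 # r), Flg := flag True))"
proof -
  let ?r = "entries encode_nat v @ 5 # r"
  have "\<exists>u x' y'. encode_nat d = u @ x' \<and> encode_nat d = u @ y' \<and>
      (cell (x' @ 4 # ?r) = 4 \<and> cell y' = 0 \<longleftrightarrow> encode_nat d = encode_nat d) \<and>
      runs (match Inp c) s (2 * length (encode_nat d) + 1)
        (s(Inp := (rev u @ l, x' @ 4 # ?r), c := (rev u @ [], y')))"
    by (rule runs_match) (use assms in \<open>auto simp: bits_encode_nat\<close>)
  then obtain u x where u: "encode_nat d = u @ x" "cell (x @ 4 # ?r) = 4" "cell x = 0"
    and 1: "runs (match Inp c) s (2 * length (encode_nat d) + 1)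
      (s(Inp := (rev u @ l, x @ 4 # ?r), c := (rev u, x)))"
    by (metis append.right_neutral same_append_eq)
  have "x = []"
    using u(1,3) encode_nat_notin(1)[of d] by (cases x) auto
  let ?s1 = "s(Inp := (rev (encode_nat d) @ l, 4 # ?r), c := (rev (encode_nat d), []))"
  have 1: "runs (match Inp c) s (2 * length (encode_nat d) + 1) ?s1"
    using 1 u(1) \<open>x = []\<close> by simp
  let ?s2 = "?s1(Flg := flag True)"
  have 2: "runs (put Flg 2) ?s1 1 ?s2"
    by (rule runs_eq[OF runs_put[of _ _ "[]" "[]"]]) (use assms in \<open>auto simp: flag_def\<close>)
  let ?s3 = "?s2(Inp := (rev (entries encode_nat (d # v)) @ l, 5 # r))"
  have 3: "runs (skip {5} Inp) ?s2 (2 * n + 1) ?s3"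
    by (rule runs_eq[OF runs_skip[of _ _ "rev (encode_nat d) @ l" "4 # entries encode_nat v" "5 # r"]])
      (use assms in \<open>auto simp: word_simps\<close>)
  have 4: "runs (if reads ?s1 Inp = 4 \<and> reads ?s1 c = 0 then put Flg 2 ;; skip {5} Inp
      else skip {4} Inp ;; right Inp ;; skip {4} Alp ;; right Alp) ?s1 (2 * n + 3) ?s3"
  proof -
    have "reads ?s1 Inp = 4 \<and> reads ?s1 c = 0"
      using assms(4) by (auto simp: reads_def)
    then show ?thesis
      using runs_Seq[OF 2 3] by (auto intro: runs_mono)
  qed
  have 5: "runs (rewind {0} c) ?s3 (2 * n + 5)
      (s(Inp := (rev (entries encode_nat (d # v)) @ l, 5 # r), Flg := flag True))"
    by (rule runs_eq[OF runs_rewind[of _ _ "rev (encode_nat d)" "[]" "[]"]])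
      (use assms in \<open>auto simp: word_simps fun_eq_iff fun_upd_apply\<close>)
  show ?thesis
    unfolding lookup_step_def
    using runs_Seq[OF 1 runs_Seq[OF runs_Cond[where Q = "\<lambda>rd. rd Inp = 4 \<and> rd c = 0", OF 4] 5]]
    by (rule runs_mono) (use assms(5) in simp)
qed

lemma runs_lookup_step_miss:
  assumes "s Inp = (l, encode_nat e @ 4 # r)" "s c = ([], encode_nat d)" "e \<noteq> d"
    and "s Alp = (l', encode_int x @ 4 # r')" "c \<notin> {Inp, Alp, Flg}"
    and "length (encode_nat e @ [4]) \<le> n" "length (encode_int x) \<le> n"
  shows "runs (lookup_step c) s (8 * n + 20)
    (s(Inp := (rev (encode_nat e @ [4]) @ l, r), Alp := (rev (encode_int x @ [4]) @ l', r')))"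
proof -
  have "\<exists>u x' y'. encode_nat e = u @ x' \<and> encode_nat d = u @ y' \<and>
      (cell (x' @ 4 # r) = 4 \<and> cell y' = 0 \<longleftrightarrow> encode_nat e = encode_nat d) \<and>
      runs (match Inp c) s (2 * length (encode_nat e) + 1)
        (s(Inp := (rev u @ l, x' @ 4 # r), c := (rev u @ [], y')))"
    by (rule runs_match) (use assms in \<open>auto simp: bits_encode_nat\<close>)
  then obtain u x' y' where u: "encode_nat e = u @ x'" "encode_nat d = u @ y'"
      "\<not> (cell (x' @ 4 # r) = 4 \<and> cell y' = 0)"
    and 1: "runs (match Inp c) s (2 * length (encode_nat e) + 1)
      (s(Inp := (rev u @ l, x' @ 4 # r), c := (rev u, y')))" (is "runs _ _ _ ?s1")
    using assms(3) by (auto simp: encode_nat_inj)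
  have notin: "0 \<notin> set u" "0 \<notin> set x'" "4 \<notin> set x'" "0 \<notin> set y'"
    using encode_nat_notin[of e] encode_nat_notin[of d] unfolding u(1,2) by auto
  let ?s2 = "?s1(Inp := (rev (encode_nat e) @ l, 4 # r))"
  have 2: "runs (skip {4} Inp) ?s1 (2 * n + 1) ?s2"
    by (rule runs_eq[OF runs_skip[of _ _ "rev u @ l" "x'" "4 # r"]])
      (use assms u notin in \<open>auto simp: fun_eq_iff fun_upd_apply\<close>)
  let ?s3 = "?s1(Inp := (rev (encode_nat e @ [4]) @ l, r))"
  have 3: "runs (right Inp) ?s2 1 ?s3"
    by (rule runs_eq[OF runs_right]) (use assms in auto)
  let ?s4 = "?s3(Alp := (rev (encode_int x) @ l', 4 # r'))"
  have 4: "runs (skip {4} Alp) ?s3 (2 * n + 1) ?s4"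
    by (rule runs_eq[OF runs_skip[of _ _ l' "encode_int x" "4 # r'"]])
      (use assms in \<open>auto simp: word_simps\<close>)
  let ?s5 = "?s3(Alp := (rev (encode_int x @ [4]) @ l', r'))"
  have 5: "runs (right Alp) ?s4 1 ?s5"
    by (rule runs_eq[OF runs_right]) (use assms in auto)
  have "reads ?s1 Inp = cell (x' @ 4 # r)" "reads ?s1 c = cell y'"
    using assms(5) by (auto simp: reads_def)
  then have 6: "runs (if reads ?s1 Inp = 4 \<and> reads ?s1 c = 0 then put Flg 2 ;; skip {5} Inp
      else skip {4} Inp ;; right Inp ;; skip {4} Alp ;; right Alp) ?s1 (4 * n + 10) ?s5"
    using runs_Seq[OF 2 runs_Seq[OF 3 runs_Seq[OF 4 5]]] u(3) by (auto intro: runs_mono)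
  have 7: "runs (rewind {0} c) ?s5 (2 * n + 5)
      (s(Inp := (rev (encode_nat e @ [4]) @ l, r), Alp := (rev (encode_int x @ [4]) @ l', r')))"
    by (rule runs_eq[OF runs_rewind[of _ _ "rev u" "[]" y']])
      (use assms u notin in \<open>auto simp: fun_eq_iff fun_upd_apply\<close>)
  show ?thesis
    unfolding lookup_step_def
    using runs_Seq[OF 1 runs_Seq[OF runs_Cond[where Q = "\<lambda>rd. rd Inp = 4 \<and> rd c = 0", OF 6] 7]]
    by (rule runs_mono) (use assms(6) in simp)
qed

text \<open>For an absent \<open>d\<close>, \<open>position v d\<close> is \<open>length v\<close>,
  so one formula for \<open>Alp\<close> covers hit and miss. The bound on \<open>length v\<close>
  ensures that every mismatch finds an entry of the vector to pass.\<close>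

lemma runs_lookup:
  assumes "s Inp = (l, entries encode_nat v @ 5 # r)" "s c = ([], encode_nat d)"
    and "s Alp = (l', entries encode_int \<alpha>)" "s Flg = flag False" "c \<notin> {Inp, Alp, Flg}"
    and "length (entries encode_nat v) \<le> n" "length (entries encode_int \<alpha>) \<le> n"
    and "length v \<le> length \<alpha>"
  shows "runs (lookup c) s (length v * (8 * n + 21) + 2)
    (s(Inp := (rev (entries encode_nat v) @ l, 5 # r), Flg := flag (d \<in> set v),
       Alp := (rev (entries encode_int (take (position v d) \<alpha>)) @ l',
               entries encode_int (drop (position v d) \<alpha>))))"
  using assms
proof (induction v arbitrary: s l l' \<alpha>)
  case Nil
  then show ?case
    unfolding lookup_def
    by (intro runs_eq[OF runs_Loop_done])
      (auto simp: reads_cell fun_eq_iff fun_upd_apply position_def)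
next
  case (Cons e v)
  \<comment> \<open>Candidate 0 is the empty word; the scanned symbol is then the terminator
    4.\<close>
  have "cell (entries encode_nat (e # v) @ 5 # r) \<noteq> 5"
    using encode_nat_notin(3)[of e] by (cases "encode_nat e") auto
  then have Q: "reads s Inp \<noteq> 5"
    using Cons.prems by (simp add: reads_cell)
  show ?case
  proof (cases "e = d")
    case True
    let ?s = "s(Inp := (rev (entries encode_nat (d # v)) @ l, 5 # r), Flg := flag True)"
    have 1: "runs (lookup_step c) s (8 * n + 20) ?s"
      by (rule runs_lookup_step_hit) (use Cons.prems True in auto)
    have 2: "runs (lookup c) ?s 1 ?s"
      unfolding lookup_def by (rule runs_Loop_done) (simp add: reads_def)
    show ?thesis
      unfolding lookup_def
      by (rule runs_eq[OF runs_Loop_step[of "\<lambda>rd. rd Inp \<noteq> 5", OF Q 1 2[unfolded lookup_def]]])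
        (use True Cons.prems in \<open>auto simp: position_def fun_eq_iff fun_upd_apply\<close>)
  next
    case False
    obtain x \<beta> where \<alpha>: "\<alpha> = x # \<beta>"
      using Cons.prems(8) by (cases \<alpha>) auto
    let ?s = "s(Inp := (rev (encode_nat e @ [4]) @ l, entries encode_nat v @ 5 # r),
      Alp := (rev (encode_int x @ [4]) @ l', entries encode_int \<beta>))"
    have 1: "runs (lookup_step c) s (8 * n + 20) ?s"
      by (rule runs_lookup_step_miss) (use Cons.prems False \<alpha> in auto)
    have 2: "runs (lookup c) ?s (length v * (8 * n + 21) + 2)
      (?s(Inp := (rev (entries encode_nat v) @ rev (encode_nat e @ [4]) @ l, 5 # r),
        Flg := flag (d \<in> set v),
        Alp := (rev (entries encode_int (take (position v d) \<beta>)) @ rev (encode_int x @ [4]) @ l',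
               entries encode_int (drop (position v d) \<beta>))))"
      by (rule Cons.IH) (use Cons.prems \<alpha> in auto)
    show ?thesis
      unfolding lookup_def
      by (rule runs_eq[OF runs_Loop_step[of "\<lambda>rd. rd Inp \<noteq> 5", OF Q 1 2[unfolded lookup_def]]])
        (use False Cons.prems \<alpha> in \<open>auto simp: position_def fun_eq_iff fun_upd_apply\<close>)
  qed
qed

section \<open>Contributions of single votes and of whole lists\<close>

definition load_weight :: "role com" where
  "load_weight = copy {4} Inp Wt ;; right Inp ;; rewind {0} Wt"

lemma runs_load_weight:
  assumes "s Inp = (l, encode_nat w @ 4 # r)" "s Wt = ([], [])" "length (encode_nat w) \<le> n"
  shows "runs load_weight s (4 * n + 10)
    (s(Inp := (rev (encode_nat w @ [4]) @ l, r), Wt := ([], encode_nat w)))"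
proof -
  let ?s1 = "s(Inp := (rev (encode_nat w) @ l, 4 # r), Wt := (rev (encode_nat w), []))"
  have 1: "runs (copy {4} Inp Wt) s (2 * n + 1) ?s1"
    by (rule runs_eq[OF runs_copy[of _ _ l "encode_nat w" "4 # r" _ "[]"]])
      (use assms in \<open>auto simp: word_simps\<close>)
  let ?s2 = "s(Inp := (rev (encode_nat w @ [4]) @ l, r), Wt := (rev (encode_nat w), []))"
  have 2: "runs (right Inp) ?s1 1 ?s2"
    by (rule runs_eq[OF runs_right]) (use assms in \<open>auto simp: fun_eq_iff fun_upd_apply\<close>)
  have 3: "runs (rewind {0} Wt) ?s2 (2 * n + 5)
      (s(Inp := (rev (encode_nat w @ [4]) @ l, r), Wt := ([], encode_nat w)))"
    by (rule runs_eq[OF runs_rewind[of _ _ "rev (encode_nat w)" "[]" "[]"]])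
      (use assms in \<open>auto simp: word_simps\<close>)
  show ?thesis
    unfolding load_weight_def using runs_Seq[OF 1 runs_Seq[OF 2 3]] by (rule runs_mono) simp
qed

text \<open>The two moves right pass the 5 that closes the vote and the 4 that ends its entry.
  \<open>Las\<close> stays at the last entry of the vector, so an unranked candidate is served
  wherever \<open>lookup\<close> has left \<open>Alp\<close>.\<close>

definition vote :: "role \<Rightarrow> role \<Rightarrow> role \<Rightarrow> role com" where
  "vote c A B =
     load_weight ;; lookup c ;; right Inp ;; right Inp ;;
     Cond (\<lambda>rd. rd Flg = 2) (muladd Alp Wt Car A B ;; put Flg 0) (muladd Las Wt Car A B) ;;
     rewind {0} Alp"

definition weight :: "role \<Rightarrow> role \<Rightarrow> role \<Rightarrow> role com" where
  "weight X A B = load_weight ;; muladd X Wt Car A B"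

definition vec_tapes :: "int list \<Rightarrow> (role \<Rightarrow> tape) \<Rightarrow> bool" where
  "vec_tapes \<alpha> s \<longleftrightarrow> \<alpha> \<noteq> [] \<and> s Alp = ([], entries encode_int \<alpha>) \<and>
     s Las = (rev (entries encode_int (butlast \<alpha>)), encode_int (last \<alpha>) @ [4]) \<and>
     s Wt = ([], []) \<and> s Car = flag False \<and> s Flg = flag False"

lemma cell_rev_entries: "cell (rev (entries enc xs)) \<in> {0, 4}"
  by (cases xs rule: rev_cases) auto

lemma position_less: "d \<in> set v \<Longrightarrow> position v d < length v"
  unfolding position_def by (induction v) auto

lemma entries_split:
  "i < length \<alpha> \<Longrightarrow> entries enc \<alpha> = entries enc (take i \<alpha>) @ enc (\<alpha> ! i) @ 4 # entries enc (drop (Suc i) \<alpha>)"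
  by (metis append_take_drop_id Cons_nth_drop_Suc entries_simps(2,3))

text \<open>\<open>n\<close> bounds the parts of the input, \<open>k\<close> the accumulators before
  the vote, and \<open>N\<close> both together, so that all costs become multiples of
  \<open>N * N\<close>. The assumption \<open>n \<le> k\<close> brings the weight under the bound
  that \<open>runs_muladd\<close> puts on its factor.\<close>

lemma runs_vote:
  assumes "s Inp = (l, encode_vote (w, v) @ 4 # r)" "s c = ([], encode_nat d)" "vec_tapes \<alpha> s"
    and "s A = ([], a)" "s B = ([], b)" "distinct [Inp, Alp, Las, Wt, Car, Flg, c, A, B]"
    and "bits a" "bits b" "length a \<le> k" "length b \<le> k" "n \<le> k" "k + n < N"
    and "length (encode_vote (w, v)) \<le> n" "length (entries encode_int \<alpha>) \<le> n"
    and "length v \<le> length \<alpha>"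
  shows "\<exists>a' b'. bits a' \<and> bits b' \<and>
    int (val a') - int (val b') = int (val a) - int (val b) + int w * roundup_points \<alpha> v d \<and>
    length a' \<le> k + n \<and> length b' \<le> k + n \<and>
    runs (vote c A B) s (150 * (N * N))
      (s(Inp := (rev (encode_vote (w, v) @ [4]) @ l, r), A := ([], a'), B := ([], b')))"
proof -
  note vec = assms(3)[unfolded vec_tapes_def]
  let ?w = "encode_nat w" and ?v = "entries encode_nat v"
  have enc: "encode_vote (w, v) = ?w @ 4 # ?v @ [5]"
    by (simp add: encode_vote_def encode_list_entries)
  have len: "length ?w \<le> n" "length ?v \<le> n" "length v \<le> n" "length \<alpha> \<le> n"
    using assms(13,14) length_le_entries[of v encode_nat] length_le_entries[of \<alpha> encode_int]
    by (auto simp: enc)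
  define i where "i = position v d"
  let ?x = "roundup_points \<alpha> v d"
  let ?s1 = "s(Inp := (rev (?w @ [4]) @ l, ?v @ 5 # 4 # r), Wt := ([], ?w))"
  have 1: "runs load_weight s (4 * n + 10) ?s1"
    by (rule runs_load_weight) (use assms enc len vec in auto)
  let ?alp = "(rev (entries encode_int (take i \<alpha>)), entries encode_int (drop i \<alpha>))"
  let ?s2 = "?s1(Inp := (rev (?w @ 4 # ?v) @ l, 5 # 4 # r), Flg := flag (d \<in> set v), Alp := ?alp)"
  have 2: "runs (lookup c) ?s1 (length v * (8 * n + 21) + 2) ?s2"
    by (rule runs_eq[OF runs_lookup[of _ "rev (?w @ [4]) @ l" v "4 # r" c d "[]" \<alpha>]])
      (use assms len vec in \<open>auto simp: i_def\<close>)
  let ?s3 = "?s2(Inp := (rev (?w @ 4 # ?v @ [5]) @ l, 4 # r))"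
  have 3: "runs (right Inp) ?s2 1 ?s3"
    by (rule runs_eq[OF runs_right]) (use assms in \<open>auto simp: fun_eq_iff fun_upd_apply\<close>)
  let ?s4 = "?s2(Inp := (rev (encode_vote (w, v) @ [4]) @ l, r))"
  have 4: "runs (right Inp) ?s3 1 ?s4"
    by (rule runs_eq[OF runs_right]) (use assms in \<open>auto simp: fun_eq_iff fun_upd_apply enc\<close>)
  \<comment> \<open>Both branches end in the same state \<open>?s5\<close>; the two extra
    transitions pay for resetting \<open>Flg\<close> after a hit.\<close>
  obtain a' b' where ab: "bits a'" "bits b'" "length a' \<le> k + n" "length b' \<le> k + n"
      "int (val a') - int (val b') = int (val a) - int (val b) + int w * ?x"
    and 5: "runs (if reads ?s4 Flg = 2 then muladd Alp Wt Car A B ;; put Flg 0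
        else muladd Las Wt Car A B) ?s4 (65 * (N * N) + 2)
      (s(Inp := (rev (encode_vote (w, v) @ [4]) @ l, r), Alp := ?alp, A := ([], a'), B := ([], b')))"
      (is "runs _ _ _ (?s5 a' b')")
  proof (cases "d \<in> set v")
    case True
    have i: "i < length \<alpha>" "?x = \<alpha> ! i"
      using position_less[OF True] assms(15) True by (auto simp: i_def roundup_points_def)
    have drop: "drop i \<alpha> = \<alpha> ! i # drop (Suc i) \<alpha>"
      using i(1) by (simp add: Cons_nth_drop_Suc)
    have x: "length (encode_int ?x) \<le> n"
      using entries_split[OF i(1), of encode_int] assms(14) i(2) by simp
    have "\<exists>a' b'. bits a' \<and> bits b' \<and>
      int (val a') - int (val b') = int (val a) - int (val b) + int (val ?w) * ?x \<and>
      length a' \<le> k + n \<and> length b' \<le> k + n \<and>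
      runs (muladd Alp Wt Car A B) ?s4 (65 * (N * N)) (?s4(A := ([], a'), B := ([], b'), Wt := ([], [])))"
      by (rule runs_muladd[where r = "entries encode_int (drop (Suc i) \<alpha>)" and
            l = "rev (entries encode_int (take i \<alpha>))"])
        (use assms vec len x drop i cell_rev_entries[of encode_int "take i \<alpha>"] in
          \<open>auto simp: word_simps bits_encode_nat\<close>)
    then obtain a' b' where ab: "bits a'" "bits b'" "length a' \<le> k + n" "length b' \<le> k + n"
      "int (val a') - int (val b') = int (val a) - int (val b) + int w * ?x"
      and 6: "runs (muladd Alp Wt Car A B) ?s4 (65 * (N * N))
        (?s4(A := ([], a'), B := ([], b'), Wt := ([], [])))"
      by (auto simp: val_encode_nat)
    have 7: "runs (put Flg 0) (?s4(A := ([], a'), B := ([], b'), Wt := ([], []))) 1 (?s5 a' b')"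
      by (rule runs_eq[OF runs_put[of _ _ "[]" "[2]"]])
        (use True assms vec in \<open>auto simp: flag_def fun_eq_iff fun_upd_apply\<close>)
    have "reads ?s4 Flg = 2"
      using True by (simp add: reads_def flag_def)
    then show thesis
      using that[OF ab] runs_Seq[OF 6 7] by (auto intro: runs_mono)
  next
    case False
    have x: "?x = last \<alpha>"
      using False by (simp add: roundup_points_def)
    have "entries encode_int \<alpha> = entries encode_int (butlast \<alpha>) @ encode_int (last \<alpha>) @ [4]"
      using vec append_butlast_last_id[of \<alpha>] entries_simps(3)[of encode_int "butlast \<alpha>" "[last \<alpha>]"]
      by simp
    then have len_x: "length (encode_int ?x) \<le> n"
      using assms(14) x by simp
    have "\<exists>a' b'. bits a' \<and> bits b' \<and>
      int (val a') - int (val b') = int (val a) - int (val b) + int (val ?w) * ?x \<and>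
      length a' \<le> k + n \<and> length b' \<le> k + n \<and>
      runs (muladd Las Wt Car A B) ?s4 (65 * (N * N)) (?s4(A := ([], a'), B := ([], b'), Wt := ([], [])))"
      by (rule runs_muladd[where r = "[]" and l = "rev (entries encode_int (butlast \<alpha>))"])
        (use assms vec len x len_x cell_rev_entries[of encode_int "butlast \<alpha>"] in
          \<open>auto simp: word_simps bits_encode_nat\<close>)
    then obtain a' b' where ab: "bits a'" "bits b'" "length a' \<le> k + n" "length b' \<le> k + n"
      "int (val a') - int (val b') = int (val a) - int (val b) + int w * ?x"
      and 6: "runs (muladd Las Wt Car A B) ?s4 (65 * (N * N))
        (?s4(A := ([], a'), B := ([], b'), Wt := ([], [])))"
      by (auto simp: val_encode_nat)
    have "runs (muladd Las Wt Car A B) ?s4 (65 * (N * N) + 2) (?s5 a' b')"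
      by (rule runs_eq[OF 6]) (use False assms vec in \<open>auto simp: fun_eq_iff fun_upd_apply\<close>)
    moreover have "reads ?s4 Flg \<noteq> 2"
      using False by (simp add: reads_def flag_def)
    ultimately show thesis
      using that[OF ab] by simp
  qed
  have 6: "runs (rewind {0} Alp) (?s5 a' b') (2 * n + 5)
      (s(Inp := (rev (encode_vote (w, v) @ [4]) @ l, r), A := ([], a'), B := ([], b')))"
  proof (rule runs_eq[OF runs_rewind])
    have "length (entries encode_int (take i \<alpha>)) \<le> length (entries encode_int \<alpha>)"
      using entries_simps(3)[of encode_int "take i \<alpha>" "drop i \<alpha>"] by simp
    then show "2 * length (rev (entries encode_int (take i \<alpha>))) + 5 \<le> 2 * n + 5"
      using assms(14) by simp
    have "entries encode_int (take i \<alpha>) @ entries encode_int (drop i \<alpha>) = entries encode_int \<alpha>"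
      by (metis append_take_drop_id entries_simps(3))
    then show "(?s5 a' b')(Alp := ([], rev (rev (entries encode_int (take i \<alpha>))) @
        entries encode_int (drop i \<alpha>))) =
      s(Inp := (rev (encode_vote (w, v) @ [4]) @ l, r), A := ([], a'), B := ([], b'))"
      using assms vec by (auto simp: fun_eq_iff fun_upd_apply)
  qed (use assms in \<open>auto simp: word_simps\<close>)
  have "length v * (8 * n + 21) \<le> N * (8 * N + 21)"
    using len assms(12) by (intro mult_le_mono) auto
  also have "\<dots> = 8 * (N * N) + 21 * N"
    by (simp add: algebra_simps)
  finally have "length v * (8 * n + 21) \<le> 8 * (N * N) + 21 * N" .
  moreover have "N \<le> N * N"
    by (rule le_square)
  ultimately have "(4 * n + 10) + ((length v * (8 * n + 21) + 2) + (1 + (1 +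
      ((65 * (N * N) + 2 + 1) + (2 * n + 5) + 1) + 1) + 1) + 1) + 1 \<le> 150 * (N * N)"
    using assms(12) by linarith
  with runs_Seq[OF 1 runs_Seq[OF 2 runs_Seq[OF 3 runs_Seq[OF 4
    runs_Seq[OF runs_Cond[where Q = "\<lambda>rd. rd Flg = 2", OF 5] 6]]]]]
  have "runs (vote c A B) s (150 * (N * N))
      (s(Inp := (rev (encode_vote (w, v) @ [4]) @ l, r), A := ([], a'), B := ([], b')))"
    unfolding vote_def by (rule runs_mono)
  with ab show ?thesis
    by blast
qed

lemma vec_tapes_upd:
  "vec_tapes \<alpha> s \<Longrightarrow> i \<notin> {Alp, Las, Wt, Car, Flg} \<Longrightarrow> vec_tapes \<alpha> (s(i := t))"
  by (auto simp: vec_tapes_def)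

lemma roundup_score_simps [simp]:
  "roundup_score \<alpha> [] d = 0"
  "roundup_score \<alpha> ((w, v) # V) d = int w * roundup_points \<alpha> v d + roundup_score \<alpha> V d"
  by (simp_all add: roundup_score_def)

text \<open>The length bound \<open>k\<close> rises by \<open>n\<close> with each vote and varies in
  the induction, whereas \<open>N\<close> is fixed beforehand so that every vote has the same
  cost.\<close>

lemma runs_votes:
  assumes "s Inp = (l, entries encode_vote S @ 5 # r)" "s c = ([], encode_nat d)" "vec_tapes \<alpha> s"
    and "s A = ([], a)" "s B = ([], b)" "distinct [Inp, Alp, Las, Wt, Car, Flg, c, A, B]"
    and "bits a" "bits b" "length a \<le> k" "length b \<le> k" "n \<le> k" "k + length S * n < N"
    and "length (entries encode_vote S) \<le> n" "length (entries encode_int \<alpha>) \<le> n"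
    and "\<forall>(w, v)\<in>set S. length v \<le> length \<alpha>"
  shows "\<exists>a' b'. bits a' \<and> bits b' \<and>
    int (val a') - int (val b') = int (val a) - int (val b) + roundup_score \<alpha> S d \<and>
    length a' \<le> k + length S * n \<and> length b' \<le> k + length S * n \<and>
    runs (Loop (\<lambda>rd. rd Inp \<noteq> 5) (vote c A B)) s (length S * (150 * (N * N) + 1) + 1)
      (s(Inp := (rev (entries encode_vote S) @ l, 5 # r), A := ([], a'), B := ([], b')))"
    (is "\<exists>a' b'. _ \<and> _ \<and> _ \<and> _ \<and> _ \<and> runs ?loop _ _ _")
  using assms
proof (induction S arbitrary: s l a b k)
  case Nil
  have "runs ?loop s 1 (s(Inp := (l, 5 # r), A := ([], a), B := ([], b)))"
    by (intro runs_eq[OF runs_Loop_done])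
      (use Nil in \<open>auto simp: reads_cell fun_eq_iff fun_upd_apply\<close>)
  then show ?case
    using Nil by (intro exI[of _ a] exI[of _ b]) auto
next
  case (Cons wv S)
  obtain w v where wv: "wv = (w, v)"
    by fastforce
  let ?s1 = "\<lambda>a b. s(Inp := (rev (encode_vote (w, v) @ [4]) @ l, entries encode_vote S @ 5 # r),
    A := ([], a), B := ([], b))"
  have "\<exists>a1 b1. bits a1 \<and> bits b1 \<and>
    int (val a1) - int (val b1) = int (val a) - int (val b) + int w * roundup_points \<alpha> v d \<and>
    length a1 \<le> k + n \<and> length b1 \<le> k + n \<and>
    runs (vote c A B) s (150 * (N * N)) (?s1 a1 b1)"
    by (rule runs_vote[where d = d]) (use Cons.prems wv in auto)
  then obtain a1 b1 where ab1: "bits a1" "bits b1" "length a1 \<le> k + n" "length b1 \<le> k + n"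
      "int (val a1) - int (val b1) = int (val a) - int (val b) + int w * roundup_points \<alpha> v d"
    and 1: "runs (vote c A B) s (150 * (N * N)) (?s1 a1 b1)"
    by blast
  have "\<exists>a' b'. bits a' \<and> bits b' \<and>
    int (val a') - int (val b') = int (val a1) - int (val b1) + roundup_score \<alpha> S d \<and>
    length a' \<le> k + n + length S * n \<and> length b' \<le> k + n + length S * n \<and>
    runs ?loop (?s1 a1 b1) (length S * (150 * (N * N) + 1) + 1)
      ((?s1 a1 b1)(Inp := (rev (entries encode_vote S) @ rev (encode_vote (w, v) @ [4]) @ l, 5 # r),
        A := ([], a'), B := ([], b')))"
  proof (rule Cons.IH)
    show "vec_tapes \<alpha> (?s1 a1 b1)"
      using Cons.prems by (intro vec_tapes_upd) auto
  qed (use Cons.prems ab1 wv in auto)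
  then obtain a' b' where ab': "bits a'" "bits b'" "length a' \<le> k + n + length S * n"
      "length b' \<le> k + n + length S * n"
      "int (val a') - int (val b') = int (val a1) - int (val b1) + roundup_score \<alpha> S d"
    and 2: "runs ?loop (?s1 a1 b1) (length S * (150 * (N * N) + 1) + 1)
      ((?s1 a1 b1)(Inp := (rev (entries encode_vote S) @ rev (encode_vote (w, v) @ [4]) @ l, 5 # r),
        A := ([], a'), B := ([], b')))"
    by blast
  \<comment> \<open>A vote begins with its weight, and weight 0 is an empty word followed by 4. So
    between votes 5 is scanned only at the end of the list, although votes contain 5
    themselves.\<close>
  have "cell (entries encode_vote (wv # S) @ 5 # r) \<noteq> 5"
    using encode_nat_notin(3)[of w]
    by (cases "encode_nat w") (auto simp: wv encode_vote_def encode_list_entries)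
  then have "reads s Inp \<noteq> 5"
    using Cons.prems by (simp add: reads_cell)
  from runs_Loop_step[of "\<lambda>rd. rd Inp \<noteq> 5", OF this 1 2]
  have "runs ?loop s (length (wv # S) * (150 * (N * N) + 1) + 1)
      (s(Inp := (rev (entries encode_vote (wv # S)) @ l, 5 # r), A := ([], a'), B := ([], b')))"
    by (rule runs_eq) (use Cons.prems wv in \<open>auto simp: fun_eq_iff fun_upd_apply\<close>)
  with ab' ab1 show ?case
    by (intro exI[of _ a'] exI[of _ b']) (auto simp: wv algebra_simps)
qed

text \<open>Under bullet votes each manipulator contributes the weight times a fixed entry: the
  first for the preferred candidate, the last for a rival. Adding the products one by one avoids a
  separate tape for the total weight.\<close>

lemma runs_weights:
  assumes "s Inp = (l, entries encode_nat T @ 5 # r)" "s Wt = ([], [])" "s Car = flag False"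
    and "s X = (lx, encode_int x @ 4 # rx)" "0 \<notin> set lx" "0 \<notin> set rx" "cell lx \<in> {0, 4}"
    and "s A = ([], a)" "s B = ([], b)" "distinct [Inp, X, Wt, Car, A, B]"
    and "bits a" "bits b" "length a \<le> k" "length b \<le> k" "n \<le> k" "k + length T * n < N"
    and "length (entries encode_nat T) \<le> n" "length (encode_int x) \<le> n"
  shows "\<exists>a' b'. bits a' \<and> bits b' \<and>
    int (val a') - int (val b') = int (val a) - int (val b) + int (sum_list T) * x \<and>
    length a' \<le> k + length T * n \<and> length b' \<le> k + length T * n \<and>
    runs (Loop (\<lambda>rd. rd Inp \<noteq> 5) (weight X A B)) s (length T * (150 * (N * N) + 1) + 1)
      (s(Inp := (rev (entries encode_nat T) @ l, 5 # r), A := ([], a'), B := ([], b')))"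
    (is "\<exists>a' b'. _ \<and> _ \<and> _ \<and> _ \<and> _ \<and> runs ?loop _ _ _")
  using assms
proof (induction T arbitrary: s l a b k)
  case Nil
  have "runs ?loop s 1 (s(Inp := (l, 5 # r), A := ([], a), B := ([], b)))"
    by (intro runs_eq[OF runs_Loop_done])
      (use Nil in \<open>auto simp: reads_cell fun_eq_iff fun_upd_apply\<close>)
  then show ?case
    using Nil by (intro exI[of _ a] exI[of _ b]) auto
next
  case (Cons w T)
  let ?s0 = "s(Inp := (rev (encode_nat w @ [4]) @ l, entries encode_nat T @ 5 # r),
    Wt := ([], encode_nat w))"
  let ?s1 = "\<lambda>a b. s(Inp := (rev (encode_nat w @ [4]) @ l, entries encode_nat T @ 5 # r),
    A := ([], a), B := ([], b))"
  have 0: "runs load_weight s (4 * n + 10) ?s0"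
    by (rule runs_load_weight) (use Cons.prems in auto)
  have "\<exists>a1 b1. bits a1 \<and> bits b1 \<and>
    int (val a1) - int (val b1) = int (val a) - int (val b) + int (val (encode_nat w)) * x \<and>
    length a1 \<le> k + n \<and> length b1 \<le> k + n \<and>
    runs (muladd X Wt Car A B) ?s0 (65 * (N * N))
      (?s0(A := ([], a1), B := ([], b1), Wt := ([], [])))"
    by (rule runs_muladd[where l = lx and r = rx]) (use Cons.prems in \<open>auto simp: bits_encode_nat\<close>)
  then obtain a1 b1 where ab1: "bits a1" "bits b1" "length a1 \<le> k + n" "length b1 \<le> k + n"
      "int (val a1) - int (val b1) = int (val a) - int (val b) + int w * x"
    and 1: "runs (muladd X Wt Car A B) ?s0 (65 * (N * N))
      (?s0(A := ([], a1), B := ([], b1), Wt := ([], [])))"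
    by (auto simp: val_encode_nat)
  have "N \<le> N * N"
    by (rule le_square)
  then have "(4 * n + 10) + 65 * (N * N) + 1 \<le> 150 * (N * N)"
    using Cons.prems(15,16) by linarith
  then have 1: "runs (weight X A B) s (150 * (N * N)) (?s1 a1 b1)"
    unfolding weight_def
    by (intro runs_eq[OF runs_Seq[OF 0 1]])
      (use Cons.prems in \<open>auto simp: fun_eq_iff fun_upd_apply\<close>)
  have "\<exists>a' b'. bits a' \<and> bits b' \<and>
    int (val a') - int (val b') = int (val a1) - int (val b1) + int (sum_list T) * x \<and>
    length a' \<le> k + n + length T * n \<and> length b' \<le> k + n + length T * n \<and>
    runs ?loop (?s1 a1 b1) (length T * (150 * (N * N) + 1) + 1)
      ((?s1 a1 b1)(Inp := (rev (entries encode_nat T) @ rev (encode_nat w @ [4]) @ l, 5 # r),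
        A := ([], a'), B := ([], b')))"
    by (rule Cons.IH) (use Cons.prems ab1 in auto)
  then obtain a' b' where ab': "bits a'" "bits b'" "length a' \<le> k + n + length T * n"
      "length b' \<le> k + n + length T * n"
      "int (val a') - int (val b') = int (val a1) - int (val b1) + int (sum_list T) * x"
    and 2: "runs ?loop (?s1 a1 b1) (length T * (150 * (N * N) + 1) + 1)
      ((?s1 a1 b1)(Inp := (rev (entries encode_nat T) @ rev (encode_nat w @ [4]) @ l, 5 # r),
        A := ([], a'), B := ([], b')))"
    by blast
  have "cell (entries encode_nat (w # T) @ 5 # r) \<noteq> 5"
    using encode_nat_notin(3)[of w] by (cases "encode_nat w") auto
  then have "reads s Inp \<noteq> 5"
    using Cons.prems by (simp add: reads_cell)
  from runs_Loop_step[of "\<lambda>rd. rd Inp \<noteq> 5", OF this 1 2]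
  have "runs ?loop s (length (w # T) * (150 * (N * N) + 1) + 1)
      (s(Inp := (rev (entries encode_nat (w # T)) @ l, 5 # r), A := ([], a'), B := ([], b')))"
    by (rule runs_eq) (use Cons.prems in \<open>auto simp: fun_eq_iff fun_upd_apply\<close>)
  with ab' ab1 show ?case
    by (intro exI[of _ a'] exI[of _ b']) (auto simp: algebra_simps)
qed

text \<open>The initial rewind allows a call from any position on \<open>Inp\<close>. Exchanging
  \<open>A\<close> and \<open>B\<close> subtracts the score instead of adding it.\<close>

definition score :: "role \<Rightarrow> role \<Rightarrow> role \<Rightarrow> role \<Rightarrow> role com" where
  "score c X A B =
     rewind {0} Inp ;; skip {5} Inp ;; right Inp ;; Loop (\<lambda>rd. rd Inp \<noteq> 5) (vote c A B) ;;
     right Inp ;; Loop (\<lambda>rd. rd Inp \<noteq> 5) (weight X A B)"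

definition input :: "int list \<Rightarrow> (nat \<times> nat list) list \<Rightarrow> nat list \<Rightarrow> nat \<Rightarrow> nat list" where
  "input \<alpha> S T p = entries encode_int \<alpha> @ 5 # entries encode_vote S @ 5 #
     entries encode_nat T @ 5 # encode_nat p"

lemma encode_vote_notin: "0 \<notin> set (encode_vote wv)"
  by (cases wv) (auto simp: encode_vote_def encode_list_entries word_simps)

lemma input_notin: "0 \<notin> set (input \<alpha> S T p)"
  by (auto simp: input_def word_simps notin_entries encode_vote_notin)

lemma runs_score:
  fixes \<alpha> S T p
  defines "x \<equiv> input \<alpha> S T p"
  defines "n \<equiv> length x"
  assumes "s Inp = (rev u, r)" "u @ r = x" "s c = ([], encode_nat d)" "vec_tapes \<alpha> s"
    and "s X = (lx, encode_int y @ 4 # rx)" "0 \<notin> set lx" "0 \<notin> set rx" "cell lx \<in> {0, 4}"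
    and "s A = ([], a)" "s B = ([], b)" "distinct [Inp, Alp, Las, Wt, Car, Flg, c, A, B]"
    and "X = Alp \<or> X = Las" "length (encode_int y) \<le> n"
    and "bits a" "bits b" "length a \<le> k" "length b \<le> k" "n \<le> k" "k + n * n < N"
    and "\<forall>(w, v)\<in>set S. length v \<le> length \<alpha>"
  shows "\<exists>a' b' u' r'. bits a' \<and> bits b' \<and> u' @ r' = x \<and>
    int (val a') - int (val b') =
      int (val a) - int (val b) + roundup_score \<alpha> S d + int (sum_list T) * y \<and>
    length a' \<le> k + n * n \<and> length b' \<le> k + n * n \<and>
    runs (score c X A B) s (320 * (N * N * N))
      (s(Inp := (rev u', r'), A := ([], a'), B := ([], b')))"
proof -
  note vec = assms(6)[unfolded vec_tapes_def]
  let ?al = "entries encode_int \<alpha>" and ?S = "entries encode_vote S" and ?T = "entries encode_nat T"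
  have len: "length ?al + length ?S + length ?T + 3 \<le> n"
    by (simp add: n_def x_def input_def)
  then have lens: "length S + length T \<le> n"
    using length_le_entries[of S encode_vote] length_le_entries[of T encode_nat] by linarith
  \<comment> \<open>Each entry occupies at least its terminator, so votes and weights number at most
    \<open>n\<close>, and one scoring lengthens the accumulators by at most \<open>n * n\<close>
    digits.\<close>
  have st: "length S * n + length T * n \<le> n * n"
    using mult_le_mono1[OF lens, of n] by (simp add: add_mult_distrib)
  have notin: "0 \<notin> set u" "0 \<notin> set r"
    using input_notin[of \<alpha> S T p] assms(4) unfolding x_def by (metis Un_iff set_append)+
  have u: "length u \<le> n"
    using assms(4) unfolding n_def by (metis le_add1 length_append)
  let ?s1 = "s(Inp := ([], x))"
  have 1: "runs (rewind {0} Inp) s (2 * n + 5) ?s1"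
    by (rule runs_eq[OF runs_rewind[of _ _ "rev u" "[]" r]])
      (use notin assms(3,4) u in auto)
  let ?s2 = "s(Inp := (rev ?al, 5 # ?S @ 5 # ?T @ 5 # encode_nat p))"
  have 2: "runs (skip {5} Inp) ?s1 (2 * n + 1) ?s2"
    by (rule runs_eq[OF runs_skip[of _ _ "[]" "?al" "5 # ?S @ 5 # ?T @ 5 # encode_nat p"]])
      (use len in \<open>auto simp: x_def input_def word_simps\<close>)
  let ?s3 = "s(Inp := (5 # rev ?al, ?S @ 5 # ?T @ 5 # encode_nat p))"
  have 3: "runs (right Inp) ?s2 1 ?s3"
    by (rule runs_eq[OF runs_right]) auto
  let ?s4 = "\<lambda>a b. s(Inp := (rev ?S @ 5 # rev ?al, 5 # ?T @ 5 # encode_nat p),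
    A := ([], a), B := ([], b))"
  have "\<exists>a1 b1. bits a1 \<and> bits b1 \<and>
    int (val a1) - int (val b1) = int (val a) - int (val b) + roundup_score \<alpha> S d \<and>
    length a1 \<le> k + length S * n \<and> length b1 \<le> k + length S * n \<and>
    runs (Loop (\<lambda>rd. rd Inp \<noteq> 5) (vote c A B)) ?s3 (length S * (150 * (N * N) + 1) + 1)
      (?s3(Inp := (rev ?S @ 5 # rev ?al, 5 # ?T @ 5 # encode_nat p), A := ([], a1), B := ([], b1)))"
  proof (rule runs_votes)
    show "vec_tapes \<alpha> ?s3"
      using assms(6) by (intro vec_tapes_upd) auto
    show "k + length S * n < N"
      using st assms(21) by linarith
  qed (use assms len in auto)
  then obtain a1 b1 where ab1: "bits a1" "bits b1" "length a1 \<le> k + length S * n"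
      "length b1 \<le> k + length S * n"
      "int (val a1) - int (val b1) = int (val a) - int (val b) + roundup_score \<alpha> S d"
    and 4: "runs (Loop (\<lambda>rd. rd Inp \<noteq> 5) (vote c A B)) ?s3 (length S * (150 * (N * N) + 1) + 1)
      (?s4 a1 b1)"
    by auto
  let ?s5 = "\<lambda>a b. s(Inp := (5 # rev ?S @ 5 # rev ?al, ?T @ 5 # encode_nat p),
    A := ([], a), B := ([], b))"
  have 5: "runs (right Inp) (?s4 a1 b1) 1 (?s5 a1 b1)"
    by (rule runs_eq[OF runs_right]) (use assms in \<open>auto simp: fun_eq_iff fun_upd_apply\<close>)
  have "\<exists>a' b'. bits a' \<and> bits b' \<and>
    int (val a') - int (val b') = int (val a1) - int (val b1) + int (sum_list T) * y \<and>
    length a' \<le> k + length S * n + length T * n \<and> length b' \<le> k + length S * n + length T * n \<and>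
    runs (Loop (\<lambda>rd. rd Inp \<noteq> 5) (weight X A B)) (?s5 a1 b1)
      (length T * (150 * (N * N) + 1) + 1)
      ((?s5 a1 b1)(Inp := (rev ?T @ 5 # rev ?S @ 5 # rev ?al, 5 # encode_nat p),
        A := ([], a'), B := ([], b')))"
  proof (rule runs_weights)
    show "k + length S * n + length T * n < N"
      using st assms(21) by linarith
    show "(?s5 a1 b1) X = (lx, encode_int y @ 4 # rx)"
      using assms(7,13,14) by auto
  qed (use assms vec len ab1 in auto)
  then obtain a' b' where ab: "bits a'" "bits b'" "length a' \<le> k + length S * n + length T * n"
      "length b' \<le> k + length S * n + length T * n"
      "int (val a') - int (val b') = int (val a1) - int (val b1) + int (sum_list T) * y"
    and 6: "runs (Loop (\<lambda>rd. rd Inp \<noteq> 5) (weight X A B)) (?s5 a1 b1)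
      (length T * (150 * (N * N) + 1) + 1)
      ((?s5 a1 b1)(Inp := (rev ?T @ 5 # rev ?S @ 5 # rev ?al, 5 # encode_nat p),
        A := ([], a'), B := ([], b')))"
    by blast
  define u' where "u' = ?al @ 5 # ?S @ 5 # ?T"
  have "n < N"
    using assms(20,21) by linarith
  have "N * 1 \<le> N * N" "N * 1 \<le> N * N * N" "1 * 1 \<le> N * N"
    using \<open>n < N\<close> by (intro mult_le_mono; simp)+
  moreover have "N * N \<le> N * N * N"
    using \<open>n < N\<close> by simp
  \<comment> \<open>Votes and weights together are fewer than \<open>N\<close>, so a single cubic
    term pays for both loops.\<close>
  moreover have "length S * (150 * (N * N) + 1) + length T * (150 * (N * N) + 1) \<le>
      N * (150 * (N * N) + 1)"
    unfolding add_mult_distrib[symmetric] using lens \<open>n < N\<close> by (intro mult_le_mono1) simp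
  moreover have "N * (150 * (N * N) + 1) = 150 * (N * N * N) + N"
    by (simp add: algebra_simps)
  ultimately have time: "(2 * n + 5) + ((2 * n + 1) + (1 + ((length S * (150 * (N * N) + 1) + 1) +
      (1 + (length T * (150 * (N * N) + 1) + 1) + 1) + 1) + 1) + 1) + 1 \<le> 320 * (N * N * N)"
    using \<open>n < N\<close> len by linarith
  have "runs (score c X A B) s (320 * (N * N * N))
      (s(Inp := (rev u', 5 # encode_nat p), A := ([], a'), B := ([], b')))"
    unfolding score_def
    by (rule runs_eq[OF runs_Seq[OF 1 runs_Seq[OF 2 runs_Seq[OF 3 runs_Seq[OF 4 runs_Seq[OF 5 6]]]]] _ time])
      (use assms in \<open>auto simp: u'_def fun_eq_iff fun_upd_apply\<close>)
  moreover have "u' @ 5 # encode_nat p = x"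
    by (simp add: u'_def x_def input_def)
  ultimately show ?thesis
    using ab ab1 st
    by (intro exI[of _ a'] exI[of _ b'] exI[of _ u'] exI[of _ "5 # encode_nat p"]) auto
qed

section \<open>The decision procedure\<close>

text \<open>The vector has as many entries as there are candidates, so passing one entry of
  \<open>Cnt\<close> per round counts the candidates although their number is not written anywhere.
  The total of the preferred candidate is recomputed in each round, at the price of a constant
  factor.\<close>

definition check_candidate :: "role com" where
  "check_candidate =
     skip {4} Cnt ;; right Cnt ;; score Cand Las Acc Bcc ;; score Pref Alp Bcc Acc ;;
     compare Acc Bcc Flg Res ;; increment Cand"

text \<open>After copying, the head of \<open>Las\<close> is past the final 4; moving onto it lets
  \<open>rewind {0, 4}\<close> run on to the start of the last entry. The name of \<open>p\<close>
  is what follows the last 5, hence the trip to the end of \<open>Inp\<close> and back.\<close>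

definition prepare :: "role com" where
  "prepare =
     copy {5} Inp Alp ;; rewind {0} Alp ;; copy {0} Alp Las ;; rewind {0} Alp ;;
     copy {0} Alp Cnt ;; rewind {0} Alp ;; rewind {0} Cnt ;; left Las ;; rewind {0, 4} Las ;;
     skip {0} Inp ;; rewind {5} Inp ;; copy {0} Inp Pref ;; rewind {0} Pref"

definition decide :: "role com" where
  "decide = prepare ;; Loop (\<lambda>rd. rd Cnt \<noteq> 0) check_candidate"

text \<open>Compares the totals under bullet votes for \<open>p\<close>. At \<open>d = p\<close> the
  right side understates the total, but \<open>last \<alpha> \<le> hd \<alpha>\<close> makes the
  strict inequality fail there, so the loop over all candidates needs no exception.\<close>

definition beats :: "int list \<Rightarrow> (nat \<times> nat list) list \<Rightarrow> nat list \<Rightarrow> nat \<Rightarrow> nat \<Rightarrow> bool" where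
  "beats \<alpha> S T p d \<longleftrightarrow>
     roundup_score \<alpha> S p + int (sum_list T) * hd \<alpha> < roundup_score \<alpha> S d + int (sum_list T) * last \<alpha>"

definition ready :: "int list \<Rightarrow> nat list \<Rightarrow> nat \<Rightarrow> (role \<Rightarrow> tape) \<Rightarrow> bool" where
  "ready \<alpha> x p s \<longleftrightarrow>
     vec_tapes \<alpha> s \<and> s Pref = ([], encode_nat p) \<and> s Acc = ([], []) \<and> s Bcc = ([], []) \<and>
     (\<exists>u r. s Inp = (rev u, r) \<and> u @ r = x)"

text \<open>Both scorings lengthen the accumulators by up to \<open>n * n\<close> digits, starting
  from the bound \<open>n\<close> that \<open>runs_score\<close> asks for; \<open>N\<close> exceeds
  the resulting \<open>n + n * n + n * n\<close>.\<close>

lemma runs_check_candidate: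
  fixes \<alpha> S T p
  defines "x \<equiv> input \<alpha> S T p"
  defines "n \<equiv> length x"
  defines "N \<equiv> 2 * ((n + 1) * (n + 1))"
  assumes "ready \<alpha> x p s" "s Cnt = (l, encode_int y @ 4 # r)" "s Cand = ([], encode_nat d)"
    and "s Res = flag q" "length (encode_int y) \<le> n" "length (encode_nat d) \<le> n"
    and "\<forall>(w, v)\<in>set S. length v \<le> length \<alpha>"
  shows "\<exists>s'. runs check_candidate s (700 * (N * N * N)) s' \<and> ready \<alpha> x p s' \<and>
    s' Cnt = (rev (encode_int y @ [4]) @ l, r) \<and> s' Cand = ([], encode_nat (Suc d)) \<and>
    s' Res = flag (q \<or> beats \<alpha> S T p d)"
proof -
  obtain u0 r0 where s: "vec_tapes \<alpha> s" "s Pref = ([], encode_nat p)" "s Acc = ([], [])"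
      "s Bcc = ([], [])" "s Inp = (rev u0, r0)" "u0 @ r0 = x"
    using assms(4) by (auto simp: ready_def)
  note vec = s(1)[unfolded vec_tapes_def]
  have al: "entries encode_int \<alpha> = encode_int (hd \<alpha>) @ 4 # entries encode_int (tl \<alpha>)"
    using vec entries_simps(2)[of encode_int "hd \<alpha>" "tl \<alpha>"] by simp
  have len: "length (entries encode_int \<alpha>) \<le> n"
    by (simp add: n_def x_def input_def)
  then have "length (encode_int (hd \<alpha>)) \<le> n"
    by (simp add: al)
  moreover have "length (encode_int (last \<alpha>)) \<le> n"
    using len vec entries_simps(3)[of encode_int "butlast \<alpha>" "[last \<alpha>]"] by simp
  ultimately have ends: "s Alp = ([], encode_int (hd \<alpha>) @ 4 # entries encode_int (tl \<alpha>))"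
      "length (encode_int (hd \<alpha>)) \<le> n" "length (encode_int (last \<alpha>)) \<le> n"
    using vec al by auto
  have N: "n + n * n + n * n < N"
    by (simp add: N_def algebra_simps)
  let ?C1 = "(rev (encode_int y) @ l, 4 # r)" and ?C = "(rev (encode_int y @ [4]) @ l, r)"
  let ?s1 = "s(Cnt := ?C1)"
  have 1: "runs (skip {4} Cnt) s (2 * n + 1) ?s1"
    by (rule runs_eq[OF runs_skip[of _ _ l "encode_int y" "4 # r"]])
      (use assms in \<open>auto simp: word_simps\<close>)
  let ?s2 = "s(Cnt := ?C)"
  have 2: "runs (right Cnt) ?s1 1 ?s2"
    by (rule runs_eq[OF runs_right]) auto
  have "\<exists>a b u r. bits a \<and> bits b \<and> u @ r = input \<alpha> S T p \<and>
    int (val a) - int (val b) =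
      int (val []) - int (val []) + roundup_score \<alpha> S d + int (sum_list T) * last \<alpha> \<and>
    length a \<le> n + length (input \<alpha> S T p) * length (input \<alpha> S T p) \<and>
    length b \<le> n + length (input \<alpha> S T p) * length (input \<alpha> S T p) \<and>
    runs (score Cand Las Acc Bcc) ?s2 (320 * (N * N * N))
      (?s2(Inp := (rev u, r), Acc := ([], a), Bcc := ([], b)))"
  proof (rule runs_score[where u = u0 and r = r0])
    show "vec_tapes \<alpha> ?s2"
      by (rule vec_tapes_upd) (use s in auto)
    show "?s2 Las = (rev (entries encode_int (butlast \<alpha>)), encode_int (last \<alpha>) @ 4 # [])"
      using vec by auto
    show "cell (rev (entries encode_int (butlast \<alpha>))) \<in> {0, 4}"
      by (rule cell_rev_entries)
  qed (use assms s ends N in \<open>auto simp: word_simps n_def x_def\<close>)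
  then obtain a1 b1 u1 r1 where ab1: "bits a1" "bits b1" "u1 @ r1 = x" "length a1 \<le> n + n * n"
      "length b1 \<le> n + n * n"
      "int (val a1) - int (val b1) = roundup_score \<alpha> S d + int (sum_list T) * last \<alpha>"
    and 3: "runs (score Cand Las Acc Bcc) ?s2 (320 * (N * N * N))
      (?s2(Inp := (rev u1, r1), Acc := ([], a1), Bcc := ([], b1)))" (is "runs _ _ _ ?s3")
    by (auto simp: n_def x_def)
  \<comment> \<open>The accumulators change places, so the total of \<open>p\<close> is subtracted
    from that of \<open>d\<close>.\<close>
  have "\<exists>b a u r. bits b \<and> bits a \<and> u @ r = input \<alpha> S T p \<and>
    int (val b) - int (val a) =
      int (val b1) - int (val a1) + roundup_score \<alpha> S p + int (sum_list T) * hd \<alpha> \<and>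
    length b \<le> n + n * n + length (input \<alpha> S T p) * length (input \<alpha> S T p) \<and>
    length a \<le> n + n * n + length (input \<alpha> S T p) * length (input \<alpha> S T p) \<and>
    runs (score Pref Alp Bcc Acc) ?s3 (320 * (N * N * N))
      (?s3(Inp := (rev u, r), Bcc := ([], b), Acc := ([], a)))"
  proof (rule runs_score[where u = u1 and r = r1])
    show "vec_tapes \<alpha> ?s3"
      by (intro vec_tapes_upd) (use s in auto)
    show "?s3 Alp = ([], encode_int (hd \<alpha>) @ 4 # entries encode_int (tl \<alpha>))"
      using ends by simp
  qed (use assms s ends ab1 N in \<open>auto simp: word_simps n_def x_def\<close>)
  then obtain b2 a2 u2 r2 where ab2: "bits a2" "bits b2" "u2 @ r2 = x"
      "length a2 \<le> n + n * n + n * n" "length b2 \<le> n + n * n + n * n"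
      "int (val b2) - int (val a2) =
        int (val b1) - int (val a1) + roundup_score \<alpha> S p + int (sum_list T) * hd \<alpha>"
    and 4: "runs (score Pref Alp Bcc Acc) ?s3 (320 * (N * N * N))
      (?s3(Inp := (rev u2, r2), Bcc := ([], b2), Acc := ([], a2)))" (is "runs _ _ _ ?s4")
    by (auto simp: n_def x_def)
  have bad: "beats \<alpha> S T p d \<longleftrightarrow> val b2 < val a2"
    using ab1(6) ab2(6) unfolding beats_def by linarith
  let ?s5 = "?s2(Inp := (rev u2, r2), Res := flag (q \<or> beats \<alpha> S T p d))"
  have 5: "runs (compare Acc Bcc Flg Res) ?s4 (10 * N + 30) ?s5"
    by (rule runs_eq[OF runs_compare[of _ _ a2 _ b2 _ _ q "n + n * n + n * n"]])
      (use assms s vec ab2 N in \<open>auto simp: bad fun_eq_iff fun_upd_apply\<close>)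
  let ?s6 = "?s5(Cand := ([], encode_nat (Suc d)))"
  have 6: "runs (increment Cand) ?s5 (4 * n + 10) ?s6"
    by (rule runs_eq[OF runs_increment[of _ _ d]]) (use assms in auto)
  have "n < N"
    using N by linarith
  then have "N * 1 \<le> N * (N * N)" "1 * 1 \<le> N * (N * N)"
    by (intro mult_le_mono; simp)+
  then have "N \<le> N * N * N" "1 \<le> N * N * N"
    by (simp_all only: mult.assoc mult_1_right)
  then have time: "(2 * n + 1) + (1 + (320 * (N * N * N) + (320 * (N * N * N) +
      ((10 * N + 30) + (4 * n + 10) + 1) + 1) + 1) + 1) + 1 \<le> 700 * (N * N * N)"
    if "2 \<le> N"
  proof -
    have "2 * (2 * 2) \<le> N * (N * N)"
      using that by (intro mult_le_mono)
    then have "8 \<le> N * N * N"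
      by (simp add: mult.assoc)
    with \<open>N \<le> N * N * N\<close> show ?thesis
      using \<open>n < N\<close> by linarith
  qed
  have "2 \<le> N"
    by (simp add: N_def)
  have "runs check_candidate s (700 * (N * N * N)) ?s6"
    unfolding check_candidate_def
    using runs_Seq[OF 1 runs_Seq[OF 2 runs_Seq[OF 3 runs_Seq[OF 4 runs_Seq[OF 5 6]]]]]
      time[OF \<open>2 \<le> N\<close>] by (rule runs_mono)
  moreover have "ready \<alpha> x p ?s6"
    unfolding ready_def using s ab2(3) by (auto intro!: vec_tapes_upd)
  ultimately show ?thesis
    by (intro exI[of _ ?s6]) auto
qed

text \<open>This crude bound is enough for the counter \<open>Cand\<close>, whose value stays within
  the length of the vector and hence of the input.\<close>

lemma length_encode_nat: "length (encode_nat n) \<le> n"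
proof (induction n rule: encode_nat.induct)
  case (1 n)
  then show ?case
    by (subst encode_nat.simps) auto
qed

text \<open>\<open>\<beta>\<close> is the part of the vector that \<open>Cnt\<close> has not yet
  passed. It serves as a unary counter, while the scores are taken from the full vector on the other
  tapes.\<close>

lemma runs_check_candidates:
  fixes \<alpha> S T p
  defines "x \<equiv> input \<alpha> S T p"
  defines "n \<equiv> length x"
  defines "N \<equiv> 2 * ((n + 1) * (n + 1))"
  assumes "ready \<alpha> x p s" "s Cnt = (l, entries encode_int \<beta>)" "s Cand = ([], encode_nat d)"
    and "s Res = flag q" "length (entries encode_int \<beta>) \<le> n" "d + length \<beta> \<le> n"
    and "\<forall>(w, v)\<in>set S. length v \<le> length \<alpha>"
  shows "\<exists>s'. runs (Loop (\<lambda>rd. rd Cnt \<noteq> 0) check_candidate) s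
      (length \<beta> * (700 * (N * N * N) + 1) + 1) s' \<and>
    s' Res = flag (q \<or> (\<exists>e. d \<le> e \<and> e < d + length \<beta> \<and> beats \<alpha> S T p e))"
  using assms(4-10)
proof (induction \<beta> arbitrary: s l d q)
  case Nil
  then have "runs (Loop (\<lambda>rd. rd Cnt \<noteq> 0) check_candidate) s 1 s"
    by (intro runs_Loop_done) (simp add: reads_cell)
  with Nil show ?case
    by (intro exI[of _ s]) (auto intro: arg_cong[where f = flag])
next
  case (Cons y \<beta>)
  have "\<exists>s'. runs check_candidate s (700 * (N * N * N)) s' \<and> ready \<alpha> x p s' \<and>
    s' Cnt = (rev (encode_int y @ [4]) @ l, entries encode_int \<beta>) \<and>
    s' Cand = ([], encode_nat (Suc d)) \<and> s' Res = flag (q \<or> beats \<alpha> S T p d)"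
    unfolding N_def n_def x_def
    by (rule runs_check_candidate)
      (use Cons.prems length_encode_nat[of d] in \<open>auto simp: n_def x_def\<close>)
  then obtain s1 where s1: "ready \<alpha> x p s1"
      "s1 Cnt = (rev (encode_int y @ [4]) @ l, entries encode_int \<beta>)"
      "s1 Cand = ([], encode_nat (Suc d))" "s1 Res = flag (q \<or> beats \<alpha> S T p d)"
    and 1: "runs check_candidate s (700 * (N * N * N)) s1"
    by blast
  obtain s' where 2: "runs (Loop (\<lambda>rd. rd Cnt \<noteq> 0) check_candidate) s1
      (length \<beta> * (700 * (N * N * N) + 1) + 1) s'"
    and s': "s' Res = flag ((q \<or> beats \<alpha> S T p d) \<or>
      (\<exists>e. Suc d \<le> e \<and> e < Suc d + length \<beta> \<and> beats \<alpha> S T p e))"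
    using Cons.IH[OF s1(1-4)] Cons.prems by auto
  have "cell (encode_int y @ 4 # entries encode_int \<beta>) \<noteq> 0"
    using encode_int_notin(1)[of y] by (cases "encode_int y") auto
  then have "reads s Cnt \<noteq> 0"
    using Cons.prems by (simp add: reads_cell)
  from runs_Loop_step[of "\<lambda>rd. rd Cnt \<noteq> 0", OF this 1 2]
  have "runs (Loop (\<lambda>rd. rd Cnt \<noteq> 0) check_candidate) s
      (length (y # \<beta>) * (700 * (N * N * N) + 1) + 1) s'"
    by (rule runs_mono) simp
  moreover have "(q \<or> beats \<alpha> S T p d) \<or>
      (\<exists>e. Suc d \<le> e \<and> e < Suc d + length \<beta> \<and> beats \<alpha> S T p e) \<longleftrightarrow>
      q \<or> (\<exists>e. d \<le> e \<and> e < d + length (y # \<beta>) \<and> beats \<alpha> S T p e)"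
    by (auto simp: Suc_le_eq) (metis le_neq_implies_less)
  ultimately show ?case
    using s' by (intro exI[of _ s']) (simp only: simp_thms)
qed

lemma runs_prepare:
  fixes \<alpha> S T p
  defines "x \<equiv> input \<alpha> S T p"
  defines "n \<equiv> length x"
  assumes "\<alpha> \<noteq> []"
  shows "\<exists>s'. runs prepare ((\<lambda>_. ([], []))(Inp := ([], x))) (30 * n + 80) s' \<and> ready \<alpha> x p s' \<and>
    s' Cnt = ([], entries encode_int \<alpha>) \<and> s' Cand = ([], encode_nat 0) \<and> s' Res = flag False"
proof -
  let ?al = "entries encode_int \<alpha>"
  define y where "y = entries encode_vote S @ 5 # entries encode_nat T @ [5]"
  have x: "x = ?al @ 5 # y @ encode_nat p" "0 \<notin> set y"
    by (auto simp: x_def input_def y_def word_simps notin_entries encode_vote_notin)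
  \<comment> \<open>\<open>y\<close> ends in the last separator 5 and \<open>encode_nat p\<close>
    contains none, so \<open>rewind {5}\<close> stops exactly in front of the name of
    \<open>p\<close>.\<close>
  have y5: "cell (rev y @ z) = 5" for z
    by (simp add: y_def)
  have al: "?al = entries encode_int (butlast \<alpha>) @ encode_int (last \<alpha>) @ [4]"
    using assms(3) append_butlast_last_id[of \<alpha>]
      entries_simps(3)[of encode_int "butlast \<alpha>" "[last \<alpha>]"] by simp
  have len: "length ?al + length y + length (encode_nat p) \<le> n"
    by (simp add: n_def x)
  then have len_last: "length (encode_int (last \<alpha>)) \<le> n"
    by (simp add: al)
  let ?init = "(\<lambda>_. ([], []))(Inp := ([], x)) :: role \<Rightarrow> tape"
  let ?s = "(\<lambda>_. ([], []))(Inp := (rev ?al, 5 # y @ encode_nat p)) :: role \<Rightarrow> tape"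
  have 1: "runs (copy {5} Inp Alp) ?init (2 * n + 1) (?s(Alp := (rev ?al, [])))"
    by (rule runs_eq[OF runs_copy[of ?init _ "[]" ?al "5 # y @ encode_nat p" _ "[]"]])
      (use len in \<open>auto simp: x word_simps\<close>)
  have rew: "runs (rewind {0} i) s (2 * n + 5) (s(i := ([], ?al)))"
    if "s i = (rev ?al, [])" for i and s :: "role \<Rightarrow> tape"
    by (rule runs_eq[OF runs_rewind[of _ _ "rev ?al" "[]" "[]"]])
      (use len that in \<open>auto simp: word_simps\<close>)
  have cop: "runs (copy {0} Alp j) s (2 * n + 1) (s(Alp := (rev ?al, []), j := (rev ?al, [])))"
    if "s Alp = ([], ?al)" "s j = ([], [])" "Alp \<noteq> j" for j and s :: "role \<Rightarrow> tape"
    by (rule runs_eq[OF runs_copy[of _ _ "[]" ?al "[]" _ "[]"]])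
      (use len that in \<open>auto simp: word_simps fun_eq_iff fun_upd_apply\<close>)
  have 2: "runs (rewind {0} Alp) (?s(Alp := (rev ?al, []))) (2 * n + 5) (?s(Alp := ([], ?al)))"
    by (rule runs_eq[OF rew]) auto
  have 3: "runs (copy {0} Alp Las) (?s(Alp := ([], ?al))) (2 * n + 1)
      (?s(Alp := (rev ?al, []), Las := (rev ?al, [])))"
    by (rule runs_eq[OF cop]) auto
  have 4: "runs (rewind {0} Alp) (?s(Alp := (rev ?al, []), Las := (rev ?al, []))) (2 * n + 5)
      (?s(Alp := ([], ?al), Las := (rev ?al, [])))"
    by (rule runs_eq[OF rew]) (auto simp: fun_eq_iff fun_upd_apply)
  have 5: "runs (copy {0} Alp Cnt) (?s(Alp := ([], ?al), Las := (rev ?al, []))) (2 * n + 1)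
      (?s(Alp := (rev ?al, []), Las := (rev ?al, []), Cnt := (rev ?al, [])))"
    by (rule runs_eq[OF cop]) (auto simp: fun_eq_iff fun_upd_apply)
  have 6: "runs (rewind {0} Alp) (?s(Alp := (rev ?al, []), Las := (rev ?al, []), Cnt := (rev ?al, [])))
      (2 * n + 5) (?s(Alp := ([], ?al), Las := (rev ?al, []), Cnt := (rev ?al, [])))"
    by (rule runs_eq[OF rew]) (auto simp: fun_eq_iff fun_upd_apply)
  have 7: "runs (rewind {0} Cnt) (?s(Alp := ([], ?al), Las := (rev ?al, []), Cnt := (rev ?al, [])))
      (2 * n + 5) (?s(Alp := ([], ?al), Las := (rev ?al, []), Cnt := ([], ?al)))"
    by (rule runs_eq[OF rew]) (auto simp: fun_eq_iff fun_upd_apply)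
  let ?las = "(rev (entries encode_int (butlast \<alpha>)), encode_int (last \<alpha>) @ [4])"
  have 8: "runs (left Las) (?s(Alp := ([], ?al), Las := (rev ?al, []), Cnt := ([], ?al))) 1
      (?s(Alp := ([], ?al), Las := (rev (encode_int (last \<alpha>)) @ rev (entries encode_int (butlast \<alpha>)), [4]),
          Cnt := ([], ?al)))"
    by (rule runs_eq[OF runs_left[of _ _ "rev ?al" "[]"]]) (auto simp: al fun_eq_iff fun_upd_apply)
  have 9: "runs (rewind {0, 4} Las)
      (?s(Alp := ([], ?al), Las := (rev (encode_int (last \<alpha>)) @ rev (entries encode_int (butlast \<alpha>)), [4]),
          Cnt := ([], ?al))) (2 * n + 5)
      (?s(Alp := ([], ?al), Las := ?las, Cnt := ([], ?al)))"
    by (rule runs_eq[OF runs_rewind[of _ _ "rev (encode_int (last \<alpha>))"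
          "rev (entries encode_int (butlast \<alpha>))" "[4]"]])
      (use len_last cell_rev_entries[of encode_int "butlast \<alpha>"] in
        \<open>auto simp: word_simps fun_eq_iff fun_upd_apply\<close>)
  let ?t = "?s(Alp := ([], ?al), Las := ?las, Cnt := ([], ?al))"
  have 10: "runs (skip {0} Inp) ?t (2 * n + 3) (?t(Inp := (rev x, [])))"
    by (rule runs_eq[OF runs_skip[of _ _ "rev ?al" "5 # y @ encode_nat p" "[]"]])
      (use len in \<open>auto simp: x word_simps\<close>)
  have 11: "runs (rewind {5} Inp) (?t(Inp := (rev x, []))) (2 * n + 5)
      (?t(Inp := (rev y @ 5 # rev ?al, encode_nat p)))"
    by (rule runs_eq[OF runs_rewind[of _ _ "rev (encode_nat p)" "rev y @ 5 # rev ?al" "[]"]])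
      (use len in \<open>auto simp: x y5 word_simps\<close>)
  have 12: "runs (copy {0} Inp Pref) (?t(Inp := (rev y @ 5 # rev ?al, encode_nat p))) (2 * n + 1)
      (?t(Inp := (rev x, []), Pref := (rev (encode_nat p), [])))"
    by (rule runs_eq[OF runs_copy[of _ _ "rev y @ 5 # rev ?al" "encode_nat p" "[]" _ "[]"]])
      (use len in \<open>auto simp: x word_simps\<close>)
  let ?f = "?t(Inp := (rev x, []), Pref := ([], encode_nat p))"
  have 13: "runs (rewind {0} Pref) (?t(Inp := (rev x, []), Pref := (rev (encode_nat p), []))) (2 * n + 5) ?f"
    by (rule runs_eq[OF runs_rewind[of _ _ "rev (encode_nat p)" "[]" "[]"]])
      (use len in \<open>auto simp: word_simps\<close>)
  have "runs prepare ?init (30 * n + 80) ?f"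
    unfolding prepare_def
    using runs_Seq[OF 1 runs_Seq[OF 2 runs_Seq[OF 3 runs_Seq[OF 4 runs_Seq[OF 5 runs_Seq[OF 6
      runs_Seq[OF 7 runs_Seq[OF 8 runs_Seq[OF 9 runs_Seq[OF 10 runs_Seq[OF 11 runs_Seq[OF 12 13]]]]]]]]]]]]
    by (rule runs_mono) linarith
  moreover have "ready \<alpha> x p ?f"
    using assms(3) by (auto simp: ready_def vec_tapes_def flag_def)
  ultimately show ?thesis
    by (intro exI[of _ ?f]) (auto simp: flag_def encode_nat.simps[of 0])
qed

lemma runs_decide:
  fixes \<alpha> S T p
  defines "x \<equiv> input \<alpha> S T p"
  assumes "\<alpha> \<noteq> []" "\<forall>(w, v)\<in>set S. length v \<le> length \<alpha>"
  shows "\<exists>s'. runs decide ((\<lambda>_. ([], []))(Inp := ([], x))) (16000 * (length x + 1) ^ 8) s' \<and>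
    (reads s' Res = 0 \<longleftrightarrow> (\<forall>d<length \<alpha>. \<not> beats \<alpha> S T p d))"
proof -
  define n where "n = length x"
  define N where "N = 2 * ((n + 1) * (n + 1))"
  obtain s1 where s1: "ready \<alpha> x p s1" "s1 Cnt = ([], entries encode_int \<alpha>)"
      "s1 Cand = ([], encode_nat 0)" "s1 Res = flag False"
    and 1: "runs prepare ((\<lambda>_. ([], []))(Inp := ([], x))) (30 * n + 80) s1"
    using runs_prepare[OF assms(2)] unfolding x_def n_def by blast
  have len: "length (entries encode_int \<alpha>) \<le> n" "length \<alpha> \<le> n"
    using length_le_entries[of \<alpha> encode_int] by (simp_all add: n_def x_def input_def)
  have "\<exists>s'. runs (Loop (\<lambda>rd. rd Cnt \<noteq> 0) check_candidate) s1
      (length \<alpha> * (700 * (N * N * N) + 1) + 1) s' \<and>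
    s' Res = flag (False \<or> (\<exists>e. 0 \<le> e \<and> e < 0 + length \<alpha> \<and> beats \<alpha> S T p e))"
    unfolding N_def n_def x_def
    by (rule runs_check_candidates) (use s1 len assms(3) in \<open>auto simp: n_def x_def\<close>)
  then obtain s' where s': "s' Res = flag (\<exists>e<length \<alpha>. beats \<alpha> S T p e)"
    and 2: "runs (Loop (\<lambda>rd. rd Cnt \<noteq> 0) check_candidate) s1
      (length \<alpha> * (700 * (N * N * N) + 1) + 1) s'"
    by auto
  have "n < N" "2 \<le> N"
    by (simp_all add: N_def)
  have "2 * 1 \<le> N * N" "N * 1 \<le> N * N" "1 * (N * N) \<le> (N * N) * (N * N)"
    using \<open>2 \<le> N\<close> by (intro mult_le_mono; simp)+
  moreover have "length \<alpha> * (700 * (N * N * N) + 1) \<le> N * (700 * (N * N * N) + 1)"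
    using len \<open>n < N\<close> by (intro mult_le_mono1) simp
  moreover have "N * (700 * (N * N * N) + 1) = 700 * ((N * N) * (N * N)) + N"
    by (simp add: algebra_simps)
  ultimately have "(30 * n + 80) + (length \<alpha> * (700 * (N * N * N) + 1) + 1) + 1 \<le>
      1000 * ((N * N) * (N * N))"
    using \<open>n < N\<close> by linarith
  also have "(N * N) * (N * N) = 16 * (n + 1) ^ 8"
  proof -
    \<comment> \<open>Stated for an arbitrary \<open>k\<close>, so that \<open>n + 1\<close> is
      treated as an atom and not expanded.\<close>
    have "2 * (k * k) * (2 * (k * k)) * (2 * (k * k) * (2 * (k * k))) = 16 * k ^ 8" for k :: nat
      by algebra
    then show ?thesis
      unfolding N_def .
  qed
  also have "1000 * (16 * (n + 1) ^ 8) = 16000 * (n + 1) ^ 8"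
    by simp
  finally have "runs decide ((\<lambda>_. ([], []))(Inp := ([], x))) (16000 * (length x + 1) ^ 8) s'"
    unfolding decide_def n_def by (rule runs_mono[OF runs_Seq[OF 1[unfolded n_def] 2]])
  moreover have "reads s' Res = 0 \<longleftrightarrow> (\<forall>d<length \<alpha>. \<not> beats \<alpha> S T p d)"
    by (simp add: reads_def s' flag_def)
  ultimately show ?thesis
    by (intro exI[of _ s'] conjI)
qed

text \<open>The alphabet consists of the blank and the symbols 1 to 5 of the encoding. Constants
  written by the program are 0, 1 and 2; everything else is copied from a scanned cell.\<close>

lemma wfc_basic [simp]:
  "wfc 6 (right i)" "wfc 6 (left i)" "wfc 6 (skip Y i)" "wfc 6 (rewind Y i)" "wfc 6 (copy Y i j)"
  "wfc 6 (clear i)" "wfc 6 (match i j)" "wfc 6 (increment i)" "a < 6 \<Longrightarrow> wfc 6 (put i a)"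
  by (auto simp: right_def left_def skip_def rewind_def copy_def clear_def match_def put_def
      increment_def fun_upd_apply split: if_splits)

lemma wfc_arith [simp]: "wfc 6 (add A W C)" "wfc 6 (muladd X W C A B)" "wfc 6 (compare A B G R)"
  by (auto simp: add_def add_step_def mul_def mul_body_def muladd_def compare_def compare_step_def
      Let_def fun_upd_apply split: if_splits)

lemma wfc_decide: "wfc 6 decide"
  by (simp add: decide_def prepare_def check_candidate_def score_def vote_def weight_def
      load_weight_def lookup_def lookup_step_def)

section \<open>Manipulation by bullet votes\<close>

lemma scoring_vector_bounds:
  assumes "scoring_vector m \<alpha>" "i < m"
  shows "last \<alpha> \<le> \<alpha> ! i" "\<alpha> ! i \<le> hd \<alpha>"
proof -
  have \<alpha>: "length \<alpha> = m" "\<alpha> \<noteq> []" "\<And>i j. i < j \<Longrightarrow> j < m \<Longrightarrow> \<alpha> ! j \<le> \<alpha> ! i"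
    using assms by (auto simp: scoring_vector_def sorted_wrt_iff_nth_less)
  show "last \<alpha> \<le> \<alpha> ! i"
    using \<alpha>(1,2) \<alpha>(3)[of i "m - 1"] assms(2) by (cases "i = m - 1") (auto simp: last_conv_nth)
  show "\<alpha> ! i \<le> hd \<alpha>"
    using \<alpha>(1,2) \<alpha>(3)[of 0 i] assms(2) by (cases "i = 0") (auto simp: hd_conv_nth)
qed

lemma top_order_length: "top_order {..<m} v \<Longrightarrow> length v \<le> m"
  unfolding top_order_def by (metis card_lessThan card_mono distinct_card finite_lessThan)

text \<open>Ranked candidates receive some entry of a decreasing vector and unranked ones its last
  entry, so all points lie between the two ends.\<close>

lemma roundup_points_bounds:
  assumes "scoring_vector m \<alpha>" "top_order {..<m} v"
  shows "last \<alpha> \<le> roundup_points \<alpha> v d" "roundup_points \<alpha> v d \<le> hd \<alpha>"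
proof -
  \<comment> \<open>An unranked candidate is compared with \<open>hd \<alpha>\<close> through index
    0, which exists because a vote is nonempty.\<close>
  have m: "0 < m"
    using assms(2) by (cases v) (auto simp: top_order_def)
  have pos: "position v d < m" if "d \<in> set v"
    using position_less[OF that] top_order_length[OF assms(2)] by simp
  show "last \<alpha> \<le> roundup_points \<alpha> v d"
    using pos scoring_vector_bounds(1)[OF assms(1)] by (auto simp: roundup_points_def)
  show "roundup_points \<alpha> v d \<le> hd \<alpha>"
    using pos scoring_vector_bounds(2)[OF assms(1)]
      order_trans[OF scoring_vector_bounds[OF assms(1) m]]
    by (auto simp: roundup_points_def)
qed

lemma roundup_score_append: "roundup_score \<alpha> (V @ V') d = roundup_score \<alpha> V d + roundup_score \<alpha> V' d"
  by (simp add: roundup_score_def)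

lemma roundup_score_bounds:
  assumes "scoring_vector m \<alpha>" "length vs = length T" "\<forall>v\<in>set vs. top_order {..<m} v"
  shows "int (sum_list T) * last \<alpha> \<le> roundup_score \<alpha> (zip T vs) d"
    and "roundup_score \<alpha> (zip T vs) d \<le> int (sum_list T) * hd \<alpha>"
proof -
  have "int (sum_list T) * last \<alpha> \<le> roundup_score \<alpha> (zip T vs) d \<and>
      roundup_score \<alpha> (zip T vs) d \<le> int (sum_list T) * hd \<alpha>"
    using assms(2)[symmetric] assms(3)
  proof (induction T vs rule: list_induct2)
    case (Cons w T v vs)
    then have "int w * last \<alpha> \<le> int w * roundup_points \<alpha> v d"
        "int w * roundup_points \<alpha> v d \<le> int w * hd \<alpha>"
      using roundup_points_bounds[OF assms(1), of v d] by (auto intro: mult_left_mono)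
    with Cons show ?case
      by (auto simp: distrib_right)
  qed simp
  then show "int (sum_list T) * last \<alpha> \<le> roundup_score \<alpha> (zip T vs) d"
    "roundup_score \<alpha> (zip T vs) d \<le> int (sum_list T) * hd \<alpha>"
    by auto
qed

text \<open>Bullet votes attain both bounds of \<open>roundup_score_bounds\<close> at once: the
  upper one for \<open>p\<close> and the lower one for every rival.\<close>

lemma roundup_score_bullet:
  assumes "\<alpha> \<noteq> []"
  shows "roundup_score \<alpha> (zip T (replicate (length T) [p])) d =
    int (sum_list T) * (if d = p then hd \<alpha> else last \<alpha>)"
  using assms
  by (induction T) (auto simp: roundup_points_def position_def hd_conv_nth distrib_right)

lemma roundup_manipulable_iff:
  assumes "scoring_vector m (X m)" "p < m"
  shows "roundup_manipulable X {..<m} S T p \<longleftrightarrow> (\<forall>d<m. \<not> beats (X m) S T p d)"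
proof
  assume "roundup_manipulable X {..<m} S T p"
  then obtain vs where vs: "length vs = length T" "\<forall>v\<in>set vs. top_order {..<m} v"
    and win: "\<And>d. d < m \<Longrightarrow>
      roundup_score (X m) (S @ zip T vs) d \<le> roundup_score (X m) (S @ zip T vs) p"
    by (auto simp: roundup_manipulable_def roundup_winner_def)
  show "\<forall>d<m. \<not> beats (X m) S T p d"
  proof (intro allI impI)
    fix d
    assume "d < m"
    \<comment> \<open>The coalition gives \<open>d\<close> at least and \<open>p\<close> at most
      what bullet votes give them, so \<open>d\<close> cannot overtake \<open>p\<close> under bullet
      votes. At \<open>d = p\<close> the two bounds alone refute \<open>beats\<close>.\<close>
    then show "\<not> beats (X m) S T p d"
      using win[of d] roundup_score_bounds(1)[OF assms(1) vs, of d]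
        roundup_score_bounds(2)[OF assms(1) vs, of p]
      by (simp add: beats_def roundup_score_append)
  qed
next
  assume *: "\<forall>d<m. \<not> beats (X m) S T p d"
  have "X m \<noteq> []"
    using assms by (auto simp: scoring_vector_def)
  with * have "roundup_winner X {..<m} (S @ zip T (replicate (length T) [p])) p"
    using assms(2)
    by (auto simp: roundup_winner_def roundup_score_append roundup_score_bullet beats_def not_less)
  then show "roundup_manipulable X {..<m} S T p"
    unfolding roundup_manipulable_def using assms(2)
    by (intro exI[of _ "replicate (length T) [p]"]) (auto simp: top_order_def)
qed

lemma set_encode_nat: "set (encode_nat n) \<subseteq> {0<..<6}"
  using bits_encode_nat[of n] by (auto simp: bits_def)

lemma set_encode_list:
  assumes "\<And>x. set (enc x) \<subseteq> {0<..<6}"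
  shows "set (encode_list enc xs) \<subseteq> {0<..<6}"
  using assms by (auto simp: encode_list_def subset_iff)

lemma set_encode_cwcm: "set (encode_cwcm X i) \<subseteq> {0<..<6}"
proof -
  have "set (encode_int x) \<subseteq> {0<..<6}" for x
    using set_encode_nat by (auto simp: encode_int_def)
  moreover have "set (encode_vote wv) \<subseteq> {0<..<6}" for wv
    by (cases wv) (simp only: encode_vote_def case_prod_conv set_encode_list set_encode_nat)
  ultimately show ?thesis
    by (cases i) (simp add: encode_cwcm_def set_encode_list set_encode_nat)
qed

lemma encode_cwcm_input: "encode_cwcm X (m, S, T, p) = input (X m) S T p"
  by (simp add: encode_cwcm_def input_def encode_list_entries)

theorem theorem2:
  fixes X :: "nat \<Rightarrow> int list"
  assumes "positional_scoring_rule X"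
  shows "polytime_decidable cwcm_instances (encode_cwcm X) (cwcm_roundup X)"
proof (rule polytime_decidableI[where c = decide and i = Inp and N = 6 and
      rs = "[Alp, Las, Cnt, Pref, Cand, Acc, Bcc, Wt, Car, Flg, Res]" and
      Q = "\<lambda>rd. rd Res = 0" and b = 16000 and d = 8])
  show "set [Inp, Alp, Las, Cnt, Pref, Cand, Acc, Bcc, Wt, Car, Flg, Res] = UNIV"
    using role.exhaust by auto
  show "\<exists>s'. runs decide ((\<lambda>_. ([], []))(Inp := ([], encode_cwcm X x)))
      (16000 * (length (encode_cwcm X x) + 1) ^ 8) s' \<and>
      (reads s' Res = 0 \<longleftrightarrow> cwcm_roundup X x)"
    if "x \<in> cwcm_instances" for x
  proof -
    obtain m S T p where x: "x = (m, S, T, p)"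
      by (cases x)
    with that have inst: "p < m" "\<forall>(w, v)\<in>set S. top_order {..<m} v"
      by (auto simp: cwcm_instances_def)
    have sv: "scoring_vector m (X m)"
      using assms by (simp add: positional_scoring_rule_def)
    then have "X m \<noteq> []" "length (X m) = m"
      using inst(1) by (auto simp: scoring_vector_def)
    moreover have "\<forall>(w, v)\<in>set S. length v \<le> length (X m)"
      using inst(2) \<open>length (X m) = m\<close> top_order_length by fastforce
    ultimately show ?thesis
      using runs_decide[of "X m" S T p] roundup_manipulable_iff[of m X p S T] sv inst(1)
      by (simp add: x encode_cwcm_input cwcm_roundup_def)
  qed
qed (simp_all add: wfc_decide set_encode_cwcm)

end
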